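(* For $\varepsilon>0$ let $(q_k,p_k,s_k)_{k\in\mathbb N}$ be the Markov chain obtained with the gle-BAOAB method $\hat\Phi^{\text{gle-BAOAB}}_{h,\mu}$ of stepsize $h>0$ with $\mu=(\mu_1,\mu_2)=(\varepsilon^{-1},\varepsilon^{-2})$, as defined in the context, started from an initial state $(q_0,p_0,s_0)$ whose law does not depend on $\varepsilon$. Let $(\hat q_k,\hat p_k)_{k\in\mathbb N}$ be the Markov chain generated by the ld-BAOAB method of stepsize $h$ (defined in the context) applied to the underdamped Langevin equation $$\dot q=p,\qquad \dot p=-\nabla U(q)-\hat\Gamma p+\sqrt{\beta^{-1}}\,\hat\Sigma\,\dot W$$ with friction tensor $\hat\Gamma=D_a^2D_b^{-1}$ and diffusion tensor $\hat\Sigma=\sqrt2\,D_aD_b^{-1/2}$, with $(\hat q_0,\hat p_0)$ distributed as $(q_0,p_0)$. Then for all $N\in\mathbb N$, $$(q_k,p_k)_{0\le k\le N}\longrightarrow(\hat q_k,\hat p_k)_{0\le k\le N}\quad\text{in law as }\varepsilon\to0 .$$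
   Context: **Setting.** $n\ge1$, $\beta>0$, $q,p,s\in\mathbb R^n$, the mass matrix is $I_n$, and $D_a=\mathrm{diag}(a_1,\dots,a_n)$, $D_b=\mathrm{diag}(b_1,\dots,b_n)$ with all $a_i,b_i>0$. The potential is $U(q)=\frac12q^T\Omega q+U_2(q)$ with $\Omega\in\mathbb R^{n\times n}$ symmetric positive definite and $U_2\in\mathcal C^\infty(\mathbb R^n,\mathbb R)$ all of whose partial derivatives of every order $k\ge1$ are bounded on $\mathbb R^n$. **gle-BAOAB with scaling $\mu=(\mu_1,\mu_2)$.** Let $$\Gamma^\mu=\begin{pmatrix}0&-\mu_1D_a\\ \mu_1D_a&\mu_2D_b\end{pmatrix}\in\mathbb R^{2n\times2n},\qquad F_h^\mu=\exp(-h\Gamma^\mu),\qquad S_h^\mu(S_h^\mu)^T=\beta^{-1}\left[I_{2n}-F_h^\mu(F_h^\mu)^T\right].$$ One step of $\hat\Phi^{\text{gle-BAOAB}}_{h,\mu}$ successively performs: $p\leftarrow p-\frac h2\nabla U(q)$; $q\leftarrow q+\frac h2p$; $(p,s)^T\leftarrow F_h^\mu(p,s)^T+S_h^\mu\mathcal R$; $q\leftarrow q+\frac h2p$; $p\leftarrow p-\frac h2\nabla U(q)$, with $\mathcal R\sim\mathcal N(0,I_{2n})$ independent of the current state and resampled independently at each step. **ld-BAOAB.** Let $\hat F_h=\exp(-h\hat\Gamma)$ and $\hat S_h\hat S_h^T=\beta^{-1}[I_n-\hat F_h\hat F_h^T]$. One step successively performs: $p\leftarrow p-\frac h2\nabla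 U(q)$; $q\leftarrow q+\frac h2p$; $p\leftarrow\hat F_hp+\hat S_h\hat{\mathcal R}$; $q\leftarrow q+\frac h2p$; $p\leftarrow p-\frac h2\nabla U(q)$, with $\hat{\mathcal R}\sim\mathcal N(0,I_n)$ independent of the current state and resampled independently at each step. *)

theory Defs
  imports "HOL-Probability.Probability"
begin

text \<open>Vectors in dimension \<open>n\<close> have type \<open>real ^ 'n\<close>; a vector of dimension \<open>2n\<close> is indexed
  by the disjoint sum \<open>'n + 'n\<close>, where \<open>Inl\<close> selects the first block and \<open>Inr\<close> the second.\<close>

section \<open>Partial derivatives and smoothness\<close>

definition partial_deriv :: "'n \<Rightarrow> (real ^ 'n \<Rightarrow> real) \<Rightarrow> real ^ 'n \<Rightarrow> real" where
  "partial_deriv i f x = deriv (\<lambda>t. f (x + t *\<^sub>R axis i 1)) 0"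

definition iter_partial :: "'n list \<Rightarrow> (real ^ 'n \<Rightarrow> real) \<Rightarrow> real ^ 'n \<Rightarrow> real" where
  "iter_partial is f = foldr partial_deriv is f"

text \<open>\<open>C\<^sup>\<infinity>\<close>: all iterated partial derivatives, of all orders including 0, exist and are continuous.
  Existence has to be stated, since \<open>deriv\<close> is total.\<close>

definition smooth_fun :: "(real ^ 'n \<Rightarrow> real) \<Rightarrow> bool" where
  "smooth_fun f \<longleftrightarrow>
     (\<forall>is. continuous_on UNIV (iter_partial is f) \<and>
       (\<forall>i x. (\<lambda>t. iter_partial is f (x + t *\<^sub>R axis i 1)) field_differentiable at 0))"

definition grad :: "(real ^ 'n \<Rightarrow> real) \<Rightarrow> real ^ 'n \<Rightarrow> real ^ 'n" where
  "grad f x = (\<chi> i. partial_deriv i f x)"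

section \<open>Matrices\<close>

definition diag_mat :: "real ^ 'n \<Rightarrow> real ^ 'n ^ 'n" where
  "diag_mat v = (\<chi> i j. if i = j then v $ i else 0)"

definition sym_pos_def :: "real ^ 'n ^ 'n \<Rightarrow> bool" where
  "sym_pos_def A \<longleftrightarrow> transpose A = A \<and> (\<forall>x. x \<noteq> 0 \<longrightarrow> 0 < x \<bullet> (A *v x))"

definition block_mat ::
  "real ^ 'n ^ 'n \<Rightarrow> real ^ 'n ^ 'n \<Rightarrow> real ^ 'n ^ 'n \<Rightarrow> real ^ 'n ^ 'n \<Rightarrow> real ^ ('n + 'n) ^ ('n + 'n)" where
  "block_mat A B C D = (\<chi> i j.
     case i of
       Inl k \<Rightarrow> (case j of Inl l \<Rightarrow> A $ k $ l | Inr l \<Rightarrow> B $ k $ l)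
     | Inr k \<Rightarrow> (case j of Inl l \<Rightarrow> C $ k $ l | Inr l \<Rightarrow> D $ k $ l))"

definition vec_join :: "real ^ 'n \<Rightarrow> real ^ 'n \<Rightarrow> real ^ ('n + 'n)" where
  "vec_join x y = (\<chi> i. case i of Inl k \<Rightarrow> x $ k | Inr k \<Rightarrow> y $ k)"

definition vec_fst :: "real ^ ('n + 'n) \<Rightarrow> real ^ 'n" where
  "vec_fst z = (\<chi> k. z $ Inl k)"

definition vec_snd :: "real ^ ('n + 'n) \<Rightarrow> real ^ 'n" where
  "vec_snd z = (\<chi> k. z $ Inr k)"

text \<open>The matrix exponential as the power series \<open>\<Sum>k. A\<^sup>k / k!\<close>. The overloaded \<open>exp\<close> does not
  apply, as matrices are not an instance of the class of real normed algebras.\<close>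

definition mat_exp :: "real ^ 'm ^ 'm \<Rightarrow> real ^ 'm ^ 'm" where
  "mat_exp A = (\<Sum>k. (1 / fact k) *\<^sub>R (((**) A) ^^ k) (mat 1))"

section \<open>Gaussian noise and convergence in law\<close>

definition std_gaussian :: "(real ^ 'm) measure" where
  "std_gaussian = density lborel (\<lambda>x. ennreal (\<Prod>i\<in>UNIV. std_normal_density (x $ i)))"

text \<open>The vectors \<open>R 0, R 1, \<dots>\<close> are i.i.d. standard Gaussian and independent of the initial state
  \<open>X\<^sub>0\<close>. Independence of \<open>X\<^sub>0\<close> and the sequence is stated on generated sigma-algebras, because
  \<open>indep_var\<close> requires both variables to have the same value type. This makes \<open>R k\<close> independent
  of the states at times \<open>0, \<dots>, k\<close> of a chain driven by \<open>R\<close>.\<close>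

definition driving_noise ::
  "'w measure \<Rightarrow> ('w \<Rightarrow> 'e::topological_space) \<Rightarrow> (nat \<Rightarrow> 'w \<Rightarrow> real ^ 'm) \<Rightarrow> bool" where
  "driving_noise M X\<^sub>0 R \<longleftrightarrow>
     prob_space M \<and>
     X\<^sub>0 \<in> borel_measurable M \<and>
     prob_space.indep_vars M (\<lambda>_. borel) R UNIV \<and>
     (\<forall>k. distr M borel (R k) = std_gaussian) \<and>
     prob_space.indep_set M
       {X\<^sub>0 -` A \<inter> space M | A. A \<in> sets borel}
       {(\<lambda>\<omega> k. R k \<omega>) -` B \<inter> space M | B. B \<in> sets (Pi\<^sub>M UNIV (\<lambda>_. borel))}"

definition weak_limit ::
  "('i \<Rightarrow> 'x::topological_space measure) \<Rightarrow> 'x measure \<Rightarrow> 'i filter \<Rightarrow> bool" where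
  "weak_limit P Q F \<longleftrightarrow>
     (\<forall>f :: 'x \<Rightarrow> real. continuous_on UNIV f \<and> bounded (range f) \<longrightarrow>
        ((\<lambda>i. \<integral>x. f x \<partial>P i) \<longlongrightarrow> (\<integral>x. f x \<partial>Q)) F)"

text \<open>The law of the path \<open>(q\<^sub>k, p\<^sub>k)\<close>, \<open>0 \<le> k \<le> N\<close>. The path is a function on \<open>nat\<close>
  that is constantly \<open>undefined\<close> beyond \<open>N\<close>; functions carry the product topology, and the
  subspace of such functions is homeomorphic to the \<open>(N+1)\<close>-fold product of the phase space.\<close>

definition path_law ::
  "'w measure \<Rightarrow> (nat \<Rightarrow> 'w \<Rightarrow> real ^ 'n) \<Rightarrow> (nat \<Rightarrow> 'w \<Rightarrow> real ^ 'n) \<Rightarrow> nat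
     \<Rightarrow> (nat \<Rightarrow> (real ^ 'n) \<times> (real ^ 'n)) measure" where
  "path_law M q p N = distr M borel (\<lambda>\<omega>. restrict (\<lambda>k. (q k \<omega>, p k \<omega>)) {..N})"

section \<open>The gle-BAOAB method\<close>

definition gle_Gamma :: "real ^ 'n \<Rightarrow> real ^ 'n \<Rightarrow> real \<Rightarrow> real \<Rightarrow> real ^ ('n + 'n) ^ ('n + 'n)" where
  "gle_Gamma a b \<mu>\<^sub>1 \<mu>\<^sub>2 =
     block_mat 0 (- \<mu>\<^sub>1 *\<^sub>R diag_mat a) (\<mu>\<^sub>1 *\<^sub>R diag_mat a) (\<mu>\<^sub>2 *\<^sub>R diag_mat b)"

definition gle_baoab_step ::
  "real \<Rightarrow> (real ^ 'n \<Rightarrow> real) \<Rightarrow> real ^ ('n + 'n) ^ ('n + 'n) \<Rightarrow> real ^ ('n + 'n) ^ ('n + 'n)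
     \<Rightarrow> real ^ ('n + 'n) \<Rightarrow> (real ^ 'n) \<times> (real ^ 'n) \<times> (real ^ 'n)
     \<Rightarrow> (real ^ 'n) \<times> (real ^ 'n) \<times> (real ^ 'n)" where
  "gle_baoab_step h U F S r = (\<lambda>(q, p, s).
     let p1 = p - (h / 2) *\<^sub>R grad U q;
         q1 = q + (h / 2) *\<^sub>R p1;
         z = F *v vec_join p1 s + S *v r;
         p2 = vec_fst z;
         s2 = vec_snd z;
         q2 = q1 + (h / 2) *\<^sub>R p2;
         p3 = p2 - (h / 2) *\<^sub>R grad U q2
     in (q2, p3, s2))"

text \<open>The noise matrix \<open>S\<close> is not unique; any choice with the prescribed \<open>S S\<^sup>T\<close> is admitted.\<close>

definition gle_baoab_chain ::
  "real \<Rightarrow> real \<Rightarrow> (real ^ 'n \<Rightarrow> real) \<Rightarrow> real ^ 'n \<Rightarrow> real ^ 'n \<Rightarrow> real \<Rightarrow> real \<Rightarrow> 'w measure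
     \<Rightarrow> (nat \<Rightarrow> 'w \<Rightarrow> real ^ 'n) \<Rightarrow> (nat \<Rightarrow> 'w \<Rightarrow> real ^ 'n) \<Rightarrow> (nat \<Rightarrow> 'w \<Rightarrow> real ^ 'n) \<Rightarrow> bool" where
  "gle_baoab_chain \<beta> h U a b \<mu>\<^sub>1 \<mu>\<^sub>2 M q p s \<longleftrightarrow>
     (\<exists>F S R.
        F = mat_exp (- h *\<^sub>R gle_Gamma a b \<mu>\<^sub>1 \<mu>\<^sub>2) \<and>
        S ** transpose S = inverse \<beta> *\<^sub>R (mat 1 - F ** transpose F) \<and>
        driving_noise M (\<lambda>\<omega>. (q 0 \<omega>, p 0 \<omega>, s 0 \<omega>)) R \<and>
        (\<forall>k. \<forall>\<omega>\<in>space M.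
           (q (Suc k) \<omega>, p (Suc k) \<omega>, s (Suc k) \<omega>)
             = gle_baoab_step h U F S (R k \<omega>) (q k \<omega>, p k \<omega>, s k \<omega>)))"

section \<open>The ld-BAOAB method\<close>

definition ld_baoab_step ::
  "real \<Rightarrow> (real ^ 'n \<Rightarrow> real) \<Rightarrow> real ^ 'n ^ 'n \<Rightarrow> real ^ 'n ^ 'n
     \<Rightarrow> real ^ 'n \<Rightarrow> (real ^ 'n) \<times> (real ^ 'n) \<Rightarrow> (real ^ 'n) \<times> (real ^ 'n)" where
  "ld_baoab_step h U F S r = (\<lambda>(q, p).
     let p1 = p - (h / 2) *\<^sub>R grad U q;
         q1 = q + (h / 2) *\<^sub>R p1;
         p2 = F *v p1 + S *v r;
         q2 = q1 + (h / 2) *\<^sub>R p2;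
         p3 = p2 - (h / 2) *\<^sub>R grad U q2
     in (q2, p3))"

text \<open>The Langevin equation \<open>dq = p dt\<close>, \<open>dp = (- \<nabla>U(q) - \<Gamma> p) dt + sqrt (1/\<beta>) \<Sigma> dW\<close> enters the
  method through its data \<open>U\<close>, \<open>\<Gamma>\<close>, \<open>\<Sigma>\<close> and \<open>\<beta>\<close>. The prescribed \<open>S S\<^sup>T\<close> is the covariance of
  the exact Ornstein-Uhlenbeck flow when \<open>\<Sigma> \<Sigma>\<^sup>T = \<Gamma> + \<Gamma>\<^sup>T\<close>, the fluctuation-dissipation
  relation, which is therefore part of the method; \<open>\<Sigma>\<close> has no further role in the scheme.\<close>

definition ld_baoab_chain ::
  "real \<Rightarrow> real \<Rightarrow> (real ^ 'n \<Rightarrow> real) \<Rightarrow> real ^ 'n ^ 'n \<Rightarrow> real ^ 'n ^ 'n \<Rightarrow> 'w measure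
     \<Rightarrow> (nat \<Rightarrow> 'w \<Rightarrow> real ^ 'n) \<Rightarrow> (nat \<Rightarrow> 'w \<Rightarrow> real ^ 'n) \<Rightarrow> bool" where
  "ld_baoab_chain \<beta> h U \<Gamma> \<Sigma> M q p \<longleftrightarrow>
     \<Sigma> ** transpose \<Sigma> = \<Gamma> + transpose \<Gamma> \<and>
     (\<exists>F S R.
        F = mat_exp (- h *\<^sub>R \<Gamma>) \<and>
        S ** transpose S = inverse \<beta> *\<^sub>R (mat 1 - F ** transpose F) \<and>
        driving_noise M (\<lambda>\<omega>. (q 0 \<omega>, p 0 \<omega>)) R \<and>
        (\<forall>k. \<forall>\<omega>\<in>space M.
           (q (Suc k) \<omega>, p (Suc k) \<omega>) = ld_baoab_step h U F S (R k \<omega>) (q k \<omega>, p k \<omega>)))"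

definition ld_friction :: "real ^ 'n \<Rightarrow> real ^ 'n \<Rightarrow> real ^ 'n ^ 'n" where
  "ld_friction a b = diag_mat a ** diag_mat a ** matrix_inv (diag_mat b)"

text \<open>For positive \<open>b\<close>, the inverse square root of the matrix \<open>D\<^sub>b = diag_mat b\<close> is the
  diagonal matrix of the numbers \<open>b\<^sub>i powr (-1/2)\<close>.\<close>

definition ld_diffusion :: "real ^ 'n \<Rightarrow> real ^ 'n \<Rightarrow> real ^ 'n ^ 'n" where
  "ld_diffusion a b = sqrt 2 *\<^sub>R (diag_mat a ** diag_mat (\<chi> i. (b $ i) powr (- 1 / 2)))"

lemma diag_mat_mult: "diag_mat u ** diag_mat v = diag_mat (\<chi> i. u $ i * v $ i)"
proof -
  have "(\<Sum>k\<in>UNIV. (if i = k then u $ i else 0) * (if k = j then v $ k else 0))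
      = (if i = j then u $ i * v $ i else 0)" for i j
  proof -
    have "(\<Sum>k\<in>UNIV. (if i = k then u $ i else 0) * (if k = j then v $ k else 0))
        = (\<Sum>k\<in>UNIV. if i = k then u $ i * (if k = j then v $ k else 0) else 0)"
      by (rule sum.cong) auto
    then show ?thesis by simp
  qed
  then show ?thesis
    by (simp add: diag_mat_def matrix_matrix_mult_def vec_eq_iff)
qed

lemma transpose_diag_mat: "transpose (diag_mat v) = diag_mat v"
  by (simp add: diag_mat_def transpose_def vec_eq_iff)

lemma matrix_inv_diag_mat:
  assumes "\<And>i. v $ i \<noteq> 0"
  shows "matrix_inv (diag_mat v) = diag_mat (\<chi> i. 1 / v $ i)"
proof -
  have one: "diag_mat (\<chi> i. 1) = mat 1"
    by (simp add: diag_mat_def mat_def vec_eq_iff)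
  let ?W = "diag_mat (\<chi> i. 1 / v $ i)"
  have W: "diag_mat v ** ?W = mat 1 \<and> ?W ** diag_mat v = mat 1"
    using assms by (simp add: diag_mat_mult one)
  have inv: "diag_mat v ** matrix_inv (diag_mat v) = mat 1"
    using someI[of "\<lambda>B. diag_mat v ** B = mat 1 \<and> B ** diag_mat v = mat 1", OF W]
    unfolding matrix_inv_def by blast
  have "matrix_inv (diag_mat v) = (?W ** diag_mat v) ** matrix_inv (diag_mat v)"
    using W by simp
  also have "\<dots> = ?W"
    by (simp only: matrix_mul_assoc[symmetric] inv matrix_mul_rid)
  finally show ?thesis .
qed

text \<open>The tensors of the theorem do satisfy the fluctuation-dissipation relation.\<close>

lemma ld_fluctuation_dissipation:
  assumes "\<And>i. 0 < b $ i"
  shows "ld_diffusion a b ** transpose (ld_diffusion a b)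
           = ld_friction a b + transpose (ld_friction a b)"
proof -
  have nz: "b $ i \<noteq> 0" for i using assms[of i] by simp
  have p: "b $ i powr (- 1 / 2) * b $ i powr (- 1 / 2) = 1 / b $ i" for i
    using assms[of i] by (simp add: powr_add[symmetric] powr_minus_divide)
  have fr: "ld_friction a b = diag_mat (\<chi> i. a $ i * a $ i / b $ i)"
    by (simp add: ld_friction_def matrix_inv_diag_mat[OF nz] diag_mat_mult)
  define w where "w = (\<chi> i. a $ i * b $ i powr (- 1 / 2))"
  have w: "w $ i * w $ i = a $ i * a $ i / b $ i" for i
  proof -
    have "w $ i * w $ i = a $ i * a $ i * (b $ i powr (- 1 / 2) * b $ i powr (- 1 / 2))"
      unfolding w_def by simp
    then show ?thesis by (simp only: p) simp
  qed
  have di: "ld_diffusion a b = diag_mat (sqrt 2 *\<^sub>R w)"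
    unfolding ld_diffusion_def diag_mat_mult w_def
    by (simp add: diag_mat_def vec_eq_iff)
  have "sqrt 2 * w $ i * (sqrt 2 * w $ i) = 2 * (a $ i * a $ i / b $ i)" for i
  proof -
    have "sqrt 2 * w $ i * (sqrt 2 * w $ i) = (sqrt 2 * sqrt 2) * (w $ i * w $ i)"
      by (simp only: ac_simps)
    then show ?thesis by (simp add: w)
  qed
  then show ?thesis
    unfolding di fr transpose_diag_mat diag_mat_mult
    by (simp add: diag_mat_def vec_eq_iff)
qed

end

theory Submission
  imports Defs "HOL-Real_Asymp.Real_Asymp"
begin

text \<open>
  A path of either scheme is a fixed function of the initial state and of the sequence of noise
  vectors, so its law is the image of \<open>\<nu> \<Otimes> (\<Otimes>\<^sub>k N(0, I))\<close> under an orbit map that depends on the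
  propagator \<open>F\<close> and the noise matrix \<open>S\<close> alone (\<open>driven_chain_path_law\<close>). This puts the chains for
  all \<open>\<epsilon>\<close>, each living on its own probability space, on one common space. There the orbit map is
  continuous in \<open>(F, S)\<close> at every noise realisation, because \<open>\<nabla>U\<close> is continuous, and dominated
  convergence turns convergence of \<open>(F, S)\<close> into convergence in law
  (\<open>integral_observed_orbit_tendsto\<close>).

  The propagator converges. After a permutation of coordinates the exponent \<open>- h \<Gamma>\<close> splits into
  \<open>2 \<times> 2\<close> blocks, damped oscillators whose fast eigenvalue \<open>\<sim> - h b / \<epsilon>\<^sup>2\<close> is killed by the
  exponential, while the slow one tends to \<open>- h a\<^sup>2 / b\<close>, the exponent of the Langevin propagator. So \<open>F\<close> tends
  to the block matrix with the Langevin propagator in its upper left corner and \<open>0\<close> elsewhere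
  (\<open>tendsto_mat_exp_gle_Gamma\<close>): in the limit \<open>s\<close> is drawn afresh in each step and decouples from
  \<open>(q, p)\<close>.

  The noise matrices need not converge, since only \<open>S S\<^sup>T\<close> is prescribed. But \<open>S S\<^sup>T\<close> converges, so
  the \<open>S\<close> are bounded and each sequence \<open>\<epsilon> \<rightarrow> 0\<close> has a subsequence along which they tend to some
  \<open>S\<^sub>0\<close>. Its Gram matrix \<open>S\<^sub>0 S\<^sub>0\<^sup>T\<close> is that of the block diagonal matrix \<open>T\<close> made of the Langevin
  noise matrix and of \<open>\<beta>\<^sup>-\<^sup>1\<^sup>/\<^sup>2 I\<close>. As this Gram matrix is invertible, \<open>S\<^sub>0 = T Q\<close> with \<open>Q\<close>
  orthogonal (\<open>equal_gram_imp_orthogonal_factor\<close>). The standard Gaussian is invariant under \<open>Q\<close>, so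
  all limit points give the same law; and with the noise matrix \<open>T\<close> the pair \<open>(q, p)\<close> performs
  exactly the Langevin scheme driven by the first half of the noise vector
  (\<open>phase_part_gle_baoab_step\<close>).
\<close>

section \<open>Block matrices and Gram matrices\<close>

lemma sum_UNIV_sum:
  fixes f :: "'a::finite + 'b::finite \<Rightarrow> 'c::comm_monoid_add"
  shows "(\<Sum>i\<in>UNIV. f i) = (\<Sum>i\<in>UNIV. f (Inl i)) + (\<Sum>i\<in>UNIV. f (Inr i))"
  by (subst UNIV_Plus_UNIV[symmetric], subst sum.Plus) simp_all

lemma prod_UNIV_sum:
  fixes f :: "'a::finite + 'b::finite \<Rightarrow> 'c::comm_monoid_mult"
  shows "(\<Prod>i\<in>UNIV. f i) = (\<Prod>i\<in>UNIV. f (Inl i)) * (\<Prod>i\<in>UNIV. f (Inr i))"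
  by (subst UNIV_Plus_UNIV[symmetric], subst prod.Plus) simp_all

lemma block_mat_mult:
  "block_mat A B C D ** block_mat A' B' C' D' =
    block_mat (A ** A' + B ** C') (A ** B' + B ** D') (C ** A' + D ** C') (C ** B' + D ** D')"
  by (simp add: vec_eq_iff block_mat_def matrix_matrix_mult_def sum_UNIV_sum split: sum.split)

lemma transpose_block_mat:
  "transpose (block_mat A B C D) =
    block_mat (transpose A) (transpose C) (transpose B) (transpose D)"
  by (simp add: vec_eq_iff block_mat_def transpose_def split: sum.split)

lemma scaleR_block_mat:
  "c *\<^sub>R block_mat A B C D = block_mat (c *\<^sub>R A) (c *\<^sub>R B) (c *\<^sub>R C) (c *\<^sub>R D)"
  by (simp add: vec_eq_iff block_mat_def split: sum.split)

lemma diff_block_mat: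
  "block_mat A B C D - block_mat A' B' C' D' = block_mat (A - A') (B - B') (C - C') (D - D')"
  by (simp add: vec_eq_iff block_mat_def split: sum.split)

lemma mat_1_block_mat: "mat 1 = block_mat (mat 1) 0 0 (mat 1)"
  by (simp add: vec_eq_iff block_mat_def mat_def split: sum.split)

lemma diag_mat_add: "diag_mat u + diag_mat v = diag_mat (\<chi> i. u $ i + v $ i)"
  by (simp add: diag_mat_def vec_eq_iff)

lemma tendsto_block_mat:
  assumes "(A \<longlongrightarrow> A') F" "(B \<longlongrightarrow> B') F" "(C \<longlongrightarrow> C') F" "(D \<longlongrightarrow> D') F"
  shows "((\<lambda>x. block_mat (A x) (B x) (C x) (D x)) \<longlongrightarrow> block_mat A' B' C' D') F"
  unfolding block_mat_def
  by (intro tendsto_vec_lambda) (auto split: sum.split intro!: tendsto_vec_nth assms)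

lemma tendsto_diag_mat:
  assumes "\<And>i. ((\<lambda>x. v x $ i) \<longlongrightarrow> w $ i) F"
  shows "((\<lambda>x. diag_mat (v x)) \<longlongrightarrow> diag_mat w) F"
  unfolding diag_mat_def by (intro tendsto_vec_lambda) (use assms in auto)

lemma tendsto_vec_join:
  assumes "(f \<longlongrightarrow> x) F" "(g \<longlongrightarrow> y) F"
  shows "((\<lambda>z. vec_join (f z) (g z)) \<longlongrightarrow> vec_join x y) F"
  unfolding vec_join_def
  by (intro tendsto_vec_lambda) (auto split: sum.split intro!: tendsto_vec_nth assms)

lemma vec_fst_block_mat_diag:
  "vec_fst (block_mat A 0 0 D *v z) = A *v vec_fst z"
  by (simp add: vec_eq_iff vec_fst_def block_mat_def matrix_vector_mult_def sum_UNIV_sum)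

lemma vec_fst_add: "vec_fst (x + y) = vec_fst x + vec_fst y"
  by (simp add: vec_fst_def vec_eq_iff)

lemma vec_fst_vec_join: "vec_fst (vec_join x y) = x"
  by (simp add: vec_fst_def vec_join_def)

lemma tendsto_matrix_vector_mult:
  fixes A :: "'a \<Rightarrow> real ^ 'n ^ 'm"
  assumes "(A \<longlongrightarrow> A') F" "(v \<longlongrightarrow> v') F"
  shows "((\<lambda>x. A x *v v x) \<longlongrightarrow> A' *v v') F"
  unfolding matrix_vector_mult_def by (intro tendsto_intros assms)

lemma tendsto_matrix_mult:
  fixes A :: "'a \<Rightarrow> real ^ 'n ^ 'm" and B :: "'a \<Rightarrow> real ^ 'k ^ 'n"
  assumes "(A \<longlongrightarrow> A') F" "(B \<longlongrightarrow> B') F"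
  shows "((\<lambda>x. A x ** B x) \<longlongrightarrow> A' ** B') F"
  unfolding matrix_matrix_mult_def by (intro tendsto_intros assms)

lemma tendsto_transpose:
  fixes A :: "'a \<Rightarrow> real ^ 'n ^ 'm"
  assumes "(A \<longlongrightarrow> A') F"
  shows "((\<lambda>x. transpose (A x)) \<longlongrightarrow> transpose A') F"
  unfolding transpose_def by (intro tendsto_intros assms)

text \<open>The Gram matrix controls the size of any of its square roots, which makes the noise matrices bounded.\<close>

lemma norm_matrix_gram: "(norm S)\<^sup>2 = trace (S ** transpose S)" for S :: "real ^ 'n ^ 'm"
  by (simp add: norm_vec_def L2_set_def sum_nonneg trace_def matrix_matrix_mult_def transpose_def power2_eq_square)

text \<open>The factor is \<open>Q = T\<^sup>-\<^sup>1 S\<close>: then \<open>Q Q\<^sup>T = T\<^sup>-\<^sup>1 (T T\<^sup>T) T\<^sup>-\<^sup>T = I\<close>. This is the sense in which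
  a prescribed covariance determines the noise matrix.\<close>

lemma equal_gram_imp_orthogonal_factor:
  fixes S T :: "real ^ 'm ^ 'm"
  assumes eq: "S ** transpose S = T ** transpose T" and inv: "invertible (T ** transpose T)"
  obtains Q where "orthogonal_matrix Q" "S = T ** Q"
proof -
  have "invertible T"
    using inv by (simp add: invertible_det_nz det_mul)
  then obtain T' where T': "T ** T' = mat 1" "T' ** T = mat 1"
    by (auto simp: invertible_def)
  have "transpose T ** transpose T' = mat 1"
    by (metis T'(2) matrix_transpose_mul transpose_mat)
  then have "(T' ** S) ** transpose (T' ** S) = mat 1"
    by (metis T'(2) eq matrix_mul_assoc matrix_mul_lid matrix_transpose_mul)
  then have "orthogonal_matrix (T' ** S)"
    by (simp add: orthogonal_matrix_def matrix_left_right_inverse)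
  moreover have "S = T ** (T' ** S)"
    by (simp add: matrix_mul_assoc T')
  ultimately show ?thesis using that by blast
qed

text \<open>Nothing relates the choices of \<open>S n\<close> for different \<open>n\<close>, so only a subsequence can be expected
  to converge. It exists by compactness, as the norms are bounded.\<close>

lemma convergent_gram_imp_convergent_subsequence:
  fixes S :: "nat \<Rightarrow> real ^ 'm ^ 'm"
  assumes "(\<lambda>n. S n ** transpose (S n)) \<longlonglongrightarrow> C"
  obtains r S\<^sub>0 where "strict_mono (r :: nat \<Rightarrow> nat)" "(\<lambda>n. S (r n)) \<longlonglongrightarrow> S\<^sub>0" "S\<^sub>0 ** transpose S\<^sub>0 = C"
proof -
  have "(\<lambda>n. trace (S n ** transpose (S n))) \<longlonglongrightarrow> trace C"
    unfolding trace_def by (intro tendsto_intros assms)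
  then have "bounded (range (\<lambda>n. (norm (S n))\<^sup>2))"
    unfolding norm_matrix_gram by (rule convergent_imp_bounded)
  then obtain B where B: "\<And>n. (norm (S n))\<^sup>2 \<le> B"
    by (auto simp: bounded_iff)
  have "bounded (range S)"
    unfolding bounded_iff using B by (auto intro!: exI[of _ "sqrt B"] real_le_rsqrt)
  then obtain S\<^sub>0 r where r: "strict_mono (r :: nat \<Rightarrow> nat)" and lim: "(\<lambda>n. S (r n)) \<longlonglongrightarrow> S\<^sub>0"
    using bounded_imp_convergent_subsequence[of S] by (auto simp: comp_def)
  have "(\<lambda>n. S (r n) ** transpose (S (r n))) \<longlonglongrightarrow> S\<^sub>0 ** transpose S\<^sub>0"
    by (intro tendsto_matrix_mult tendsto_transpose lim)
  moreover have "(\<lambda>n. S (r n) ** transpose (S (r n))) \<longlonglongrightarrow> C"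
    using LIMSEQ_subseq_LIMSEQ[OF assms r] by (simp add: comp_def)
  ultimately show ?thesis
    using that r lim LIMSEQ_unique by blast
qed

section \<open>The overdamped limit of the propagator\<close>

text \<open>If every entry of \<open>A\<^sup>k\<close> is a combination of \<open>k\<close>-th powers of two numbers, possibly different ones
  for different entries, then summing the exponential series replaces those powers by exponentials.\<close>

lemma mat_exp_eq_two_exponentials:
  fixes A :: "real ^ 'm ^ 'm"
  assumes "\<And>k i j. (((**) A) ^^ k) (mat 1) $ i $ j = P i j * l i j ^ k + Q i j * m i j ^ k"
  shows "mat_exp A = (\<chi> i j. P i j * exp (l i j) + Q i j * exp (m i j))"
proof -
  have exp: "(\<lambda>k. z ^ k / fact k) sums exp z" for z :: real
    using exp_converges[of z] by (simp add: divide_inverse mult.commute)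
  have "(\<lambda>k. (1 / fact k) *\<^sub>R (((**) A) ^^ k) (mat 1)) sums
      (\<chi> i j. P i j * exp (l i j) + Q i j * exp (m i j))"
    unfolding sums_def
  proof (intro vec_tendstoI)
    fix i j
    have "(\<lambda>k. P i j * (l i j ^ k / fact k) + Q i j * (m i j ^ k / fact k)) sums
        (P i j * exp (l i j) + Q i j * exp (m i j))"
      by (intro sums_add sums_mult exp)
    then show "(\<lambda>n. (\<Sum>k<n. (1 / fact k) *\<^sub>R (((**) A) ^^ k) (mat 1)) $ i $ j) \<longlonglongrightarrow>
        (\<chi> i j. P i j * exp (l i j) + Q i j * exp (m i j)) $ i $ j"
      by (simp add: sums_def assms field_simps)
  qed
  then show ?thesis
    unfolding mat_exp_def by (rule sums_unique[symmetric])
qed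

lemma mat_exp_diag_mat: "mat_exp (diag_mat v) = diag_mat (\<chi> i. exp (v $ i))"
proof -
  have pow: "(((**) (diag_mat v)) ^^ k) (mat 1) = diag_mat (\<chi> i. v $ i ^ k)" for k
  proof (induction k)
    case 0
    show ?case by (simp add: mat_def diag_mat_def vec_eq_iff)
  next
    case (Suc k)
    then show ?case by (simp add: diag_mat_mult)
  qed
  have "(((**) (diag_mat v)) ^^ k) (mat 1) $ i $ j = (if i = j then 1 else 0) * v $ i ^ k + 0 * 0 ^ k"
    for k i j
    by (simp add: pow) (simp add: diag_mat_def)
  then have "mat_exp (diag_mat v) = (\<chi> i j. (if i = j then 1 else 0) * exp (v $ i) + 0 * exp 0)"
    by (rule mat_exp_eq_two_exponentials)
  then show ?thesis
    by (auto simp: diag_mat_def vec_eq_iff)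
qed

text \<open>The \<open>i\<close>-th block is \<open>B = (0, c; -c, -d)\<close>, of trace \<open>- d\<close> and determinant \<open>c\<^sup>2\<close>, with eigenvalues \<open>l\<close>
  and \<open>m\<close>. The formula is the Lagrange interpolation
  \<open>exp B = (exp l (B - m I) - exp m (B - l I)) / (l - m)\<close>, where \<open>- d - m = l\<close> and \<open>- d - l = m\<close>
  simplify the last entry. By Cayley-Hamilton the same interpolation holds for \<open>B\<^sup>k\<close>.\<close>

lemma mat_exp_oscillator_blocks:
  fixes c d l m :: "real ^ 'n"
  assumes sum: "\<And>i. l $ i + m $ i = - d $ i" and prod: "\<And>i. l $ i * m $ i = (c $ i)\<^sup>2"
    and ne: "\<And>i. l $ i \<noteq> m $ i"
  shows "mat_exp (block_mat 0 (diag_mat c) (diag_mat (- c)) (diag_mat (- d))) =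
    block_mat
      (diag_mat (\<chi> i. (l $ i * exp (m $ i) - m $ i * exp (l $ i)) / (l $ i - m $ i)))
      (diag_mat (\<chi> i. c $ i * (exp (l $ i) - exp (m $ i)) / (l $ i - m $ i)))
      (diag_mat (\<chi> i. - c $ i * (exp (l $ i) - exp (m $ i)) / (l $ i - m $ i)))
      (diag_mat (\<chi> i. (l $ i * exp (l $ i) - m $ i * exp (m $ i)) / (l $ i - m $ i)))"
    (is "mat_exp ?A = _")
proof -
  \<comment> \<open>the interpolation formula with values \<open>u\<close> at the eigenvalue \<open>l\<close> and \<open>v\<close> at \<open>m\<close>; powers and
    exponential are the same expression in different \<open>u\<close> and \<open>v\<close>\<close>
  define E where "E = (\<lambda>u v. block_mat
      (diag_mat (\<chi> i. (l $ i * v i - m $ i * u i) / (l $ i - m $ i)))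
      (diag_mat (\<chi> i. c $ i * (u i - v i) / (l $ i - m $ i)))
      (diag_mat (\<chi> i. - c $ i * (u i - v i) / (l $ i - m $ i)))
      (diag_mat (\<chi> i. (l $ i * u i - m $ i * v i) / (l $ i - m $ i))))"
  have pow: "(((**) ?A) ^^ k) (mat 1) = E (\<lambda>i. l $ i ^ k) (\<lambda>i. m $ i ^ k)" for k
  proof (induction k)
    case 0
    show ?case
      unfolding E_def using ne
      by (simp add: mat_1_block_mat) (simp add: diag_mat_def mat_def vec_eq_iff block_mat_def split: sum.split)
  next
    case (Suc k)
    have z: "(0 :: real ^ 'n ^ 'n) = diag_mat 0" by (simp add: diag_mat_def vec_eq_iff)
    have 1: "0 $ i * w + c $ i * (- c $ i * (u - v) / (l $ i - m $ i)) =
        (l $ i * (m $ i * v) - m $ i * (l $ i * u)) / (l $ i - m $ i)" for i u v w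
    proof -
      have "c $ i * (- c $ i * (u - v)) = l $ i * (m $ i * v) - m $ i * (l $ i * u)"
        using prod[of i] by algebra
      then show ?thesis by (simp only: times_divide_eq_right zero_index mult_zero_left add_0_left)
    qed
    have 2: "0 $ i * w + c $ i * ((l $ i * u - m $ i * v) / (l $ i - m $ i)) =
        c $ i * (l $ i * u - m $ i * v) / (l $ i - m $ i)" for i u v w
      by simp
    have 3: "(- c) $ i * ((l $ i * v - m $ i * u) / (l $ i - m $ i)) +
        (- d) $ i * (- c $ i * (u - v) / (l $ i - m $ i)) =
        - c $ i * (l $ i * u - m $ i * v) / (l $ i - m $ i)" for i u v
    proof -
      have "(- c $ i) * (l $ i * v - m $ i * u) + (- d $ i) * (- c $ i * (u - v)) =
          - c $ i * (l $ i * u - m $ i * v)"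
        using sum[of i] by algebra
      then show ?thesis
        by (simp only: times_divide_eq_right add_divide_distrib[symmetric] vector_uminus_component)
    qed
    have 4: "(- c) $ i * (c $ i * (u - v) / (l $ i - m $ i)) +
        (- d) $ i * ((l $ i * u - m $ i * v) / (l $ i - m $ i)) =
        (l $ i * (l $ i * u) - m $ i * (m $ i * v)) / (l $ i - m $ i)" for i u v
    proof -
      have "(- c $ i) * (c $ i * (u - v)) + (- d $ i) * (l $ i * u - m $ i * v) =
          l $ i * (l $ i * u) - m $ i * (m $ i * v)"
        using sum[of i] prod[of i] by algebra
      then show ?thesis
        by (simp only: times_divide_eq_right add_divide_distrib[symmetric] vector_uminus_component)
    qed
    have "(((**) ?A) ^^ Suc k) (mat 1) = ?A ** E (\<lambda>i. l $ i ^ k) (\<lambda>i. m $ i ^ k)"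
      by (simp add: Suc)
    also have "\<dots> = E (\<lambda>i. l $ i ^ Suc k) (\<lambda>i. m $ i ^ Suc k)"
      unfolding E_def block_mat_mult z diag_mat_mult diag_mat_add
      by (intro arg_cong4[where f = block_mat] arg_cong[where f = diag_mat])
         (simp_all only: vec_eq_iff vec_lambda_beta power_Suc 1 2 3 4 simp_thms)
    finally show ?case .
  qed
  \<comment> \<open>\<open>E\<close> is linear in \<open>(u, v)\<close>, and \<open>case_sum id id i\<close> is the number of the block containing row \<open>i\<close>\<close>
  have lin: "E u v $ i $ j = E (\<lambda>_. 1) (\<lambda>_. 0) $ i $ j * u (case_sum id id i) +
      E (\<lambda>_. 0) (\<lambda>_. 1) $ i $ j * v (case_sum id id i)" for u v i j
    by (simp add: E_def block_mat_def diag_mat_def diff_divide_distrib algebra_simps split: sum.split)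
  have "(((**) ?A) ^^ k) (mat 1) $ i $ j =
      E (\<lambda>_. 1) (\<lambda>_. 0) $ i $ j * (l $ case_sum id id i) ^ k +
      E (\<lambda>_. 0) (\<lambda>_. 1) $ i $ j * (m $ case_sum id id i) ^ k" for k i j
    unfolding pow by (rule lin)
  from mat_exp_eq_two_exponentials[of ?A, OF this]
  have "mat_exp ?A = E (\<lambda>i. exp (l $ i)) (\<lambda>i. exp (m $ i))"
    by (simp only: vec_eq_iff vec_lambda_beta lin[of "\<lambda>i. exp (l $ i)" "\<lambda>i. exp (m $ i)"] simp_thms)
  then show ?thesis
    by (simp add: E_def)
qed

text \<open>Here \<open>l\<close> and \<open>m\<close> are the roots of \<open>z\<^sup>2 + (h b / e\<^sup>2) z + (h a / e)\<^sup>2\<close>. As \<open>e \<rightarrow> 0\<close>, the slow root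
  \<open>l\<close> tends to \<open>- h a\<^sup>2 / b\<close> and the fast root \<open>m\<close> behaves like \<open>- h b / e\<^sup>2\<close>. In particular the
  coupling \<open>h a / e\<close> is of smaller order than \<open>l - m\<close>, so the off-diagonal entry vanishes.\<close>

lemma damped_oscillator_exp_limits:
  fixes a b h :: real
  assumes "a > 0" "b > 0" "h > 0"
  defines "l \<equiv> (\<lambda>e. h * (- b + sqrt (b\<^sup>2 - 4 * a\<^sup>2 * e\<^sup>2)) / (2 * e\<^sup>2))"
    and "m \<equiv> (\<lambda>e. h * (- b - sqrt (b\<^sup>2 - 4 * a\<^sup>2 * e\<^sup>2)) / (2 * e\<^sup>2))"
  shows "((\<lambda>e. (l e * exp (m e) - m e * exp (l e)) / (l e - m e)) \<longlongrightarrow> exp (- h * (a * a / b))) (at_right 0)"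
    and "((\<lambda>e. h * inverse e * a * (exp (l e) - exp (m e)) / (l e - m e)) \<longlongrightarrow> 0) (at_right 0)"
    and "((\<lambda>e. (l e * exp (l e) - m e * exp (m e)) / (l e - m e)) \<longlongrightarrow> 0) (at_right 0)"
proof -
  show "((\<lambda>e. (l e * exp (m e) - m e * exp (l e)) / (l e - m e)) \<longlongrightarrow> exp (- h * (a * a / b))) (at_right 0)"
    using assms(1-3) unfolding l_def m_def by real_asymp (use assms(1-3) in \<open>simp add: field_simps power2_eq_square\<close>)
  show "((\<lambda>e. h * inverse e * a * (exp (l e) - exp (m e)) / (l e - m e)) \<longlongrightarrow> 0) (at_right 0)"
    using assms(1-3) unfolding l_def m_def by real_asymp
  show "((\<lambda>e. (l e * exp (l e) - m e * exp (m e)) / (l e - m e)) \<longlongrightarrow> 0) (at_right 0)"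
    using assms(1-3) unfolding l_def m_def by real_asymp
qed

lemma ld_friction_eq:
  assumes "\<And>i. b $ i > 0"
  shows "ld_friction a b = diag_mat (\<chi> i. a $ i * a $ i / b $ i)"
  using assms by (simp add: ld_friction_def matrix_inv_diag_mat less_imp_neq[symmetric] diag_mat_mult)

lemma tendsto_mat_exp_gle_Gamma:
  fixes a b :: "real ^ 'n"
  assumes a: "\<And>i. a $ i > 0" and b: "\<And>i. b $ i > 0" and h: "h > 0"
  shows "((\<lambda>\<epsilon>. mat_exp (- h *\<^sub>R gle_Gamma a b (inverse \<epsilon>) (inverse (\<epsilon>\<^sup>2)))) \<longlongrightarrow>
          block_mat (mat_exp (- h *\<^sub>R ld_friction a b)) 0 0 0) (at_right 0)"
proof -
  define l where "l = (\<lambda>e i. h * (- (b $ i) + sqrt ((b $ i)\<^sup>2 - 4 * (a $ i)\<^sup>2 * e\<^sup>2)) / (2 * e\<^sup>2))"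
  define m where "m = (\<lambda>e i. h * (- (b $ i) - sqrt ((b $ i)\<^sup>2 - 4 * (a $ i)\<^sup>2 * e\<^sup>2)) / (2 * e\<^sup>2))"
  define E where "E = (\<lambda>e. block_mat
      (diag_mat (\<chi> i. (l e i * exp (m e i) - m e i * exp (l e i)) / (l e i - m e i)))
      (diag_mat (\<chi> i. h * inverse e * a $ i * (exp (l e i) - exp (m e i)) / (l e i - m e i)))
      (diag_mat (\<chi> i. - (h * inverse e * a $ i * (exp (l e i) - exp (m e i)) / (l e i - m e i))))
      (diag_mat (\<chi> i. (l e i * exp (l e i) - m e i * exp (m e i)) / (l e i - m e i))))"
  have z: "(0 :: real ^ 'n ^ 'n) = diag_mat 0" by (simp add: diag_mat_def vec_eq_iff)
  have fr: "- h *\<^sub>R ld_friction a b = diag_mat (\<chi> i. - h * (a $ i * a $ i / b $ i))"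
    unfolding ld_friction_eq[OF b] by (simp add: diag_mat_def vec_eq_iff)
  have lim: "(E \<longlongrightarrow> block_mat (mat_exp (- h *\<^sub>R ld_friction a b)) 0 0 0) (at_right 0)"
    unfolding E_def fr mat_exp_diag_mat z
    by (intro tendsto_block_mat tendsto_diag_mat)
       (use damped_oscillator_exp_limits[OF a b h] tendsto_minus[OF damped_oscillator_exp_limits(2)[OF a b h]] in \<open>simp_all add: l_def m_def\<close>)
  \<comment> \<open>for small \<open>e\<close> all oscillators are overdamped and have two distinct real eigenvalues\<close>
  have "\<forall>\<^sub>F e in at_right 0. \<forall>i. (b $ i)\<^sup>2 - 4 * (a $ i)\<^sup>2 * e\<^sup>2 > 0"
  proof (rule eventually_all_finite)
    fix i
    have "((\<lambda>e. (b $ i)\<^sup>2 - 4 * (a $ i)\<^sup>2 * e\<^sup>2) \<longlongrightarrow> (b $ i)\<^sup>2 - 4 * (a $ i)\<^sup>2 * 0\<^sup>2) (at_right 0)"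
      by (intro tendsto_intros)
    then show "\<forall>\<^sub>F e in at_right 0. (b $ i)\<^sup>2 - 4 * (a $ i)\<^sup>2 * e\<^sup>2 > 0"
      by (rule order_tendstoD(1)) (use b[of i] in simp)
  qed
  moreover have "\<forall>\<^sub>F e in at_right (0::real). e > 0"
    by (rule eventually_at_right_less)
  ultimately have "\<forall>\<^sub>F e in at_right 0. E e = mat_exp (- h *\<^sub>R gle_Gamma a b (inverse e) (inverse (e\<^sup>2)))"
  proof eventually_elim
    case (elim e)
    have ne: "l e i \<noteq> m e i" for i
      using elim h less_imp_neq[OF elim(1)[rule_format, of i]]
      by (simp add: l_def m_def field_simps)
    have sum: "l e i + m e i = - (h * inverse (e\<^sup>2) * b $ i)" for i
      using elim by (simp add: l_def m_def field_simps)
    have prod: "l e i * m e i = (h * inverse e * a $ i)\<^sup>2" for i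
    proof -
      define r where "r = sqrt ((b $ i)\<^sup>2 - 4 * (a $ i)\<^sup>2 * e\<^sup>2)"
      have r: "r\<^sup>2 = (b $ i)\<^sup>2 - 4 * (a $ i)\<^sup>2 * e\<^sup>2"
        using elim by (simp add: r_def less_imp_le)
      have "l e i * m e i = h\<^sup>2 * ((b $ i)\<^sup>2 - r\<^sup>2) / (2 * e\<^sup>2)\<^sup>2"
        unfolding l_def m_def r_def[symmetric] by (simp add: power2_eq_square algebra_simps)
      also have "\<dots> = (h * inverse e * a $ i)\<^sup>2"
        using elim unfolding r by (simp add: field_simps power2_eq_square)
      finally show ?thesis .
    qed
    have "- h *\<^sub>R gle_Gamma a b (inverse e) (inverse (e\<^sup>2)) =
        block_mat 0 (diag_mat (\<chi> i. h * inverse e * a $ i)) (diag_mat (- (\<chi> i. h * inverse e * a $ i)))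
          (diag_mat (- (\<chi> i. h * inverse (e\<^sup>2) * b $ i)))"
      by (simp add: gle_Gamma_def scaleR_block_mat) (simp add: block_mat_def diag_mat_def vec_eq_iff split: sum.split)
    then show ?case
      using mat_exp_oscillator_blocks[of "\<chi> i. l e i" "\<chi> i. m e i" "\<chi> i. h * inverse (e\<^sup>2) * b $ i"
         "\<chi> i. h * inverse e * a $ i"] sum prod ne
      by (simp add: E_def)
  qed
  then show ?thesis
    using lim by (rule Lim_transform_eventually[rotated])
qed

section \<open>Invariance and marginals of the standard Gaussian\<close>

text \<open>Translations and point reflections preserve Lebesgue measure on every Euclidean space. These
  symmetries suffice for the rotation invariance below.\<close>

lemma lborel_distr_reflect:
  "distr lborel borel (\<lambda>x. t - x) = (lborel :: 'a::euclidean_space measure)"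
  by (subst (2) lborel_affine[of "-1" t]) (simp_all add: density_1)

lemma nn_integral_lborel_reflect:
  fixes f :: "'a::euclidean_space \<Rightarrow> ennreal"
  assumes [measurable]: "f \<in> borel_measurable borel"
  shows "(\<integral>\<^sup>+x. f (t - x) \<partial>lborel) = (\<integral>\<^sup>+x. f x \<partial>lborel)"
  by (subst (2) lborel_distr_reflect[of t, symmetric]) (simp add: nn_integral_distr)

lemma nn_integral_lborel_translate:
  fixes f :: "'a::euclidean_space \<Rightarrow> ennreal"
  assumes [measurable]: "f \<in> borel_measurable borel"
  shows "(\<integral>\<^sup>+x. f (t + x) \<partial>lborel) = (\<integral>\<^sup>+x. f x \<partial>lborel)"
  by (subst (2) lborel_distr_plus[of t, symmetric]) (simp add: nn_integral_distr)

text \<open>The Fubini argument for uniqueness of Haar measure: Lebesgue measure and its image under \<open>T\<close> are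
  both invariant under translations and reflections. In \<open>\<integral>\<integral> f(x) g(y)\<close>, with \<open>x\<close> distributed by the
  image measure and \<open>y\<close> by Lebesgue measure, reflect \<open>x \<mapsto> y - x\<close>, then translate \<open>y \<mapsto> y + x\<close>, and
  finally translate \<open>x \<mapsto> x - y\<close>; this exchanges the roles of \<open>f\<close> and \<open>g\<close>.\<close>

lemma nn_integral_lborel_orthogonal_mult:
  fixes f g :: "'a::euclidean_space \<Rightarrow> ennreal" and T :: "'a \<Rightarrow> 'a"
  assumes T: "orthogonal_transformation T"
    and [measurable]: "f \<in> borel_measurable borel" "g \<in> borel_measurable borel"
  shows "(\<integral>\<^sup>+x. f (T x) \<partial>lborel) * (\<integral>\<^sup>+y. g y \<partial>lborel) =
         (\<integral>\<^sup>+y. f y \<partial>lborel) * (\<integral>\<^sup>+x. g (T x) \<partial>lborel)"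
proof -
  have lin: "linear T"
    using T by (rule orthogonal_transformation_linear)
  have T_meas[measurable]: "T \<in> borel_measurable borel"
    using lin by (intro borel_measurable_continuous_onI linear_continuous_on linear_conv_bounded_linear[THEN iffD1])
  \<comment> \<open>the image measure inherits the symmetries, with \<open>y\<close> replaced by a preimage under \<open>T\<close>\<close>
  obtain T' where T': "\<And>y. T (T' y) = y"
    using orthogonal_transformation_surj[OF T] by (metis surj_def)
  have refl: "(\<integral>\<^sup>+x. k (T x) \<partial>lborel) = (\<integral>\<^sup>+x. k (y - T x) \<partial>lborel)"
    if [measurable]: "k \<in> borel_measurable borel" for k :: "'a \<Rightarrow> ennreal" and y
  proof -
    have "y - T x = T (T' y - x)" for x
      by (simp add: linear_diff[OF lin] T')
    then show ?thesis
      using nn_integral_lborel_reflect[of "\<lambda>x. k (T x)" "T' y"] by simp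
  qed
  have trans: "(\<integral>\<^sup>+x. k (y + T x) \<partial>lborel) = (\<integral>\<^sup>+x. k (T x) \<partial>lborel)"
    if [measurable]: "k \<in> borel_measurable borel" for k :: "'a \<Rightarrow> ennreal" and y
  proof -
    have "y + T x = T (T' y + x)" for x
      by (simp add: linear_add[OF lin] T')
    then show ?thesis
      using nn_integral_lborel_translate[of "\<lambda>x. k (T x)" "T' y"] by simp
  qed
  have "(\<integral>\<^sup>+x. f (T x) \<partial>lborel) * (\<integral>\<^sup>+y. g y \<partial>lborel) =
      (\<integral>\<^sup>+y. (\<integral>\<^sup>+x. f (T x) \<partial>lborel) * g y \<partial>lborel)"
    by (simp add: nn_integral_cmult)
  also have "\<dots> = (\<integral>\<^sup>+y. \<integral>\<^sup>+x. f (y - T x) * g y \<partial>lborel \<partial>lborel)"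
  proof (rule nn_integral_cong)
    fix y
    show "(\<integral>\<^sup>+x. f (T x) \<partial>lborel) * g y = (\<integral>\<^sup>+x. f (y - T x) * g y \<partial>lborel)"
      using refl[of f y] by (simp add: nn_integral_multc)
  qed
  also have "\<dots> = (\<integral>\<^sup>+x. \<integral>\<^sup>+y. f (y - T x) * g y \<partial>lborel \<partial>lborel)"
    by (rule lborel_pair.Fubini') measurable
  also have "\<dots> = (\<integral>\<^sup>+x. \<integral>\<^sup>+y. f y * g (y + T x) \<partial>lborel \<partial>lborel)"
  proof (rule nn_integral_cong)
    fix x
    show "(\<integral>\<^sup>+y. f (y - T x) * g y \<partial>lborel) = (\<integral>\<^sup>+y. f y * g (y + T x) \<partial>lborel)"
      using nn_integral_lborel_translate[of "\<lambda>y. f (y - T x) * g y" "T x"] by (simp add: add.commute)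
  qed
  also have "\<dots> = (\<integral>\<^sup>+y. \<integral>\<^sup>+x. f y * g (y + T x) \<partial>lborel \<partial>lborel)"
    by (rule lborel_pair.Fubini') measurable
  also have "\<dots> = (\<integral>\<^sup>+y. f y * (\<integral>\<^sup>+x. g (T x) \<partial>lborel) \<partial>lborel)"
    by (intro nn_integral_cong) (simp add: nn_integral_cmult trans[of g])
  also have "\<dots> = (\<integral>\<^sup>+y. f y \<partial>lborel) * (\<integral>\<^sup>+x. g (T x) \<partial>lborel)"
    by (simp add: nn_integral_multc)
  finally show ?thesis .
qed

text \<open>By the preceding lemma the image measure is proportional to Lebesgue measure, and testing with the
  unit ball, which \<open>T\<close> preserves, shows that the factor is \<open>1\<close>.\<close>

lemma lborel_distr_orthogonal:
  fixes T :: "'a::euclidean_space \<Rightarrow> 'a"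
  assumes T: "orthogonal_transformation T"
  shows "distr lborel borel T = lborel"
proof (rule measure_eqI)
  have [measurable]: "T \<in> borel_measurable borel"
    using orthogonal_transformation_linear[OF T]
    by (intro borel_measurable_continuous_onI linear_continuous_on linear_conv_bounded_linear[THEN iffD1])
  fix A assume "A \<in> sets (distr lborel borel T)"
  then have [measurable]: "A \<in> sets borel" by simp
  have ball: "indicator (ball 0 1) (T x) = (indicator (ball 0 1) x :: ennreal)" for x
    using orthogonal_transformation_norm[OF T] by (simp add: indicator_def)
  have "emeasure (distr lborel borel T) A * emeasure lborel (ball (0::'a) 1) =
      (\<integral>\<^sup>+x. indicator A (T x) \<partial>lborel) * (\<integral>\<^sup>+y. indicator (ball (0::'a) 1) y \<partial>lborel)"
    by (simp add: nn_integral_distr flip: nn_integral_indicator)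
  also have "\<dots> = emeasure lborel A * emeasure lborel (ball (0::'a) 1)"
    by (subst nn_integral_lborel_orthogonal_mult[OF T]) (simp_all add: ball borel_measurable_indicator)
  finally show "emeasure (distr lborel borel T) A = emeasure lborel A"
    using emeasure_lborel_ball_finite[of "0::'a" 1] content_ball_pos[of 1 "0::'a"]
    by (auto simp: mult.commute[of _ "emeasure lborel (ball 0 1)"] ennreal_mult_cancel_left measure_def)
qed simp

lemma std_gaussian_eq:
  "(std_gaussian :: (real ^ 'm) measure) =
    density lborel (\<lambda>x. ennreal ((1 / sqrt (2 * pi)) ^ CARD('m) * exp (- (norm x)\<^sup>2 / 2)))"
proof -
  have "(\<Prod>i\<in>UNIV. std_normal_density (x $ i)) = (1 / sqrt (2 * pi)) ^ CARD('m) * exp (- (norm x)\<^sup>2 / 2)"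
    for x :: "real ^ 'm"
    by (simp add: normal_density_def std_normal_density_def prod_dividef exp_sum[symmetric] norm_vec_def L2_set_def
        sum_nonneg sum_negf sum_divide_distrib power_one_over)
  then show ?thesis by (simp add: std_gaussian_def)
qed

lemma sets_std_gaussian [measurable_cong, simp]: "sets std_gaussian = sets borel"
  and space_std_gaussian [simp]: "space std_gaussian = UNIV"
  by (simp_all add: std_gaussian_def)

text \<open>The density depends on the norm alone, and Lebesgue measure is rotation invariant.\<close>

lemma std_gaussian_distr_orthogonal:
  fixes Q :: "real ^ 'm ^ 'm"
  assumes "orthogonal_matrix Q"
  shows "distr std_gaussian borel ((*v) Q) = std_gaussian"
proof -
  have T: "orthogonal_transformation ((*v) Q)"
    using assms by (simp add: orthogonal_transformation_matrix)
  have [measurable]: "(*v) Q \<in> borel_measurable borel"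
    by (intro borel_measurable_continuous_onI continuous_intros)
  let ?g = "\<lambda>x::real^'m. ennreal ((1 / sqrt (2 * pi)) ^ CARD('m) * exp (- (norm x)\<^sup>2 / 2))"
  have "distr (density lborel (\<lambda>x. ?g (Q *v x))) borel ((*v) Q) = density (distr lborel borel ((*v) Q)) ?g"
    by (rule density_distr[symmetric]) measurable
  then show ?thesis
    by (simp add: std_gaussian_eq lborel_distr_orthogonal[OF T] orthogonal_transformation_norm[OF T])
qed

lemma prod_Basis_cart: "(\<Prod>b\<in>Basis. v \<bullet> b) = (\<Prod>i\<in>UNIV. v $ i)" for v :: "real ^ 'n"
  by (simp add: Basis_vec_def cart_eq_inner_axis axis_eq_axis prod.UNION_disjoint)

lemma measurable_vec_join [measurable]:
  "(\<lambda>(x, y). vec_join x y) \<in> borel_measurable (borel \<Otimes>\<^sub>M borel :: ((real ^ 'n) \<times> (real ^ 'n)) measure)"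
  unfolding borel_prod
proof (rule borel_measurable_continuous_onI)
  have "continuous_on UNIV (\<lambda>z :: (real ^ 'n) \<times> (real ^ 'n). case i of Inl k \<Rightarrow> fst z $ k | Inr k \<Rightarrow> snd z $ k)" for i
    by (cases i) (auto intro!: continuous_intros)
  then show "continuous_on UNIV (\<lambda>(x :: real ^ 'n, y). vec_join x y)"
    unfolding vec_join_def case_prod_unfold by (intro continuous_on_vec_lambda)
qed

lemma lborel_distr_vec_join:
  "distr (lborel \<Otimes>\<^sub>M lborel) borel (\<lambda>(x, y). vec_join x y) = (lborel :: (real ^ ('n::finite + 'n)) measure)"
proof (rule lborel_eqI[symmetric])
  fix l u :: "real ^ ('n + 'n)"
  assume "\<And>b. b \<in> Basis \<Longrightarrow> l \<bullet> b \<le> u \<bullet> b"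
  then have le: "l $ i \<le> u $ i" for i
    by (force simp: Basis_vec_def inner_axis)
  have le_b: "vec_fst l \<bullet> b \<le> vec_fst u \<bullet> b \<and> vec_snd l \<bullet> b \<le> vec_snd u \<bullet> b" if "b \<in> Basis" for b
    using le that by (auto simp: Basis_vec_def inner_axis vec_fst_def vec_snd_def)
  have "(\<lambda>(x, y). vec_join x y) -` box l u \<inter> space (lborel \<Otimes>\<^sub>M lborel) =
      box (vec_fst l) (vec_fst u) \<times> box (vec_snd l) (vec_snd u)"
    by (auto simp: space_pair_measure mem_box_cart vec_join_def vec_fst_def vec_snd_def split: sum.split_asm sum.split)
  then have "emeasure (distr (lborel \<Otimes>\<^sub>M lborel) borel (\<lambda>(x, y). vec_join x y)) (box l u) =
      emeasure lborel (box (vec_fst l) (vec_fst u)) * emeasure lborel (box (vec_snd l) (vec_snd u))"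
    by (simp add: emeasure_distr lborel.emeasure_pair_measure_Times)
  also have "\<dots> = (\<Prod>b\<in>Basis. (u - l) \<bullet> b)"
    using le le_b unfolding prod_Basis_cart[of "u - l"]
    by (simp add: prod_Basis_cart ennreal_mult[symmetric] prod_nonneg vec_fst_def vec_snd_def prod_UNIV_sum)
  finally show "emeasure (distr (lborel \<Otimes>\<^sub>M lborel) borel (\<lambda>(x, y). vec_join x y)) (box l u) =
    (\<Prod>b\<in>Basis. (u - l) \<bullet> b)" .
qed simp

lemma measurable_vec_fst [measurable]:
  "vec_fst \<in> borel_measurable (borel :: (real ^ ('n::finite + 'n)) measure)"
  unfolding vec_fst_def by (intro borel_measurable_continuous_onI continuous_intros)

text \<open>The density factorises over the two blocks, so the \<open>2n\<close>-dimensional Gaussian is the product of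
  two \<open>n\<close>-dimensional ones, of which \<open>vec_fst\<close> picks the first.\<close>

lemma std_gaussian_distr_vec_fst:
  assumes "prob_space (std_gaussian :: (real ^ 'n) measure)"
  shows "distr (std_gaussian :: (real ^ ('n + 'n)) measure) borel vec_fst = std_gaussian"
proof -
  interpret prob_space "std_gaussian :: (real ^ 'n) measure" by fact
  let ?J = "\<lambda>(x :: real ^ 'n, y). vec_join x y"
  let ?f = "\<lambda>x :: real ^ 'n. ennreal (\<Prod>i\<in>UNIV. std_normal_density (x $ i))"
  let ?g = "\<lambda>x :: real ^ ('n + 'n). ennreal (\<Prod>i\<in>UNIV. std_normal_density (x $ i))"
  have g: "?g (?J z) = (case z of (x, y) \<Rightarrow> ?f x * ?f y)" for z
    by (auto simp: prod_UNIV_sum vec_join_def prod_nonneg ennreal_mult split: prod.split)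
  have "std_gaussian = density (distr (lborel \<Otimes>\<^sub>M lborel) borel ?J) ?g"
    by (simp add: std_gaussian_def lborel_distr_vec_join)
  also have "\<dots> = distr (density (lborel \<Otimes>\<^sub>M lborel) (\<lambda>z. ?g (?J z))) borel ?J"
    by (rule density_distr) measurable
  also have "density (lborel \<Otimes>\<^sub>M lborel) (\<lambda>z. ?g (?J z)) = std_gaussian \<Otimes>\<^sub>M std_gaussian"
    unfolding g unfolding std_gaussian_def
    by (rule pair_measure_density[symmetric])
       (use sigma_finite_measure in \<open>simp_all add: std_gaussian_def[symmetric] sigma_finite_lborel\<close>)
  finally have "distr (std_gaussian :: (real ^ ('n + 'n)) measure) borel vec_fst =
      distr (distr (std_gaussian \<Otimes>\<^sub>M std_gaussian) borel ?J) borel vec_fst"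
    by simp
  also have "\<dots> = distr (std_gaussian \<Otimes>\<^sub>M std_gaussian) std_gaussian (fst :: (real ^ 'n) \<times> (real ^ 'n) \<Rightarrow> _)"
    by (subst distr_distr) (auto intro!: distr_cong simp: vec_fst_def vec_join_def)
  also have "\<dots> = std_gaussian"
    by (rule distr_pair_fst)
  finally show ?thesis .
qed

section \<open>Chains driven by independent noise\<close>

fun driven_orbit :: "('r \<Rightarrow> 'x \<Rightarrow> 'x) \<Rightarrow> 'x \<Rightarrow> (nat \<Rightarrow> 'r) \<Rightarrow> nat \<Rightarrow> 'x" where
  "driven_orbit \<Phi> x r 0 = x"
| "driven_orbit \<Phi> x r (Suc k) = \<Phi> (r k) (driven_orbit \<Phi> x r k)"

text \<open>The path map of a random dynamical system. The observable \<open>\<pi>\<close> allows coordinates of the state to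
  be hidden, and the default value beyond \<open>N\<close> is the one used by \<open>path_law\<close>.\<close>

definition observed_orbit ::
  "('x \<Rightarrow> 'y) \<Rightarrow> ('r \<Rightarrow> 'x \<Rightarrow> 'x) \<Rightarrow> nat \<Rightarrow> 'x \<times> (nat \<Rightarrow> 'r) \<Rightarrow> nat \<Rightarrow> 'y" where
  "observed_orbit \<pi> \<Phi> N = (\<lambda>(x, r). restrict (\<lambda>k. \<pi> (driven_orbit \<Phi> x r k)) {..N})"

lemma measurable_observed_orbit:
  fixes \<Phi> :: "'r::second_countable_topology \<Rightarrow> 'x::second_countable_topology \<Rightarrow> 'x"
    and \<pi> :: "'x \<Rightarrow> 'y::second_countable_topology"
  assumes \<Phi>: "(\<lambda>(r, x). \<Phi> r x) \<in> borel_measurable borel" and \<pi>[measurable]: "\<pi> \<in> borel_measurable borel"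
  shows "observed_orbit \<pi> \<Phi> N \<in> borel_measurable (borel \<Otimes>\<^sub>M Pi\<^sub>M UNIV (\<lambda>_. borel))"
proof -
  have [measurable]: "(\<lambda>(r, x). \<Phi> r x) \<in> borel_measurable (borel \<Otimes>\<^sub>M borel)"
    unfolding borel_prod by (rule \<Phi>)
  have [measurable]: "(\<lambda>(x, r). driven_orbit \<Phi> x r k) \<in> borel_measurable (borel \<Otimes>\<^sub>M Pi\<^sub>M UNIV (\<lambda>_. borel))" for k
    by (induction k) (simp_all, measurable)
  show ?thesis
    unfolding observed_orbit_def
    by (rule measurable_coordinatewise_then_product) (auto simp: case_prod_unfold restrict_def)
qed

text \<open>The independence assumptions say precisely that initial state and noise sequence have a product
  law; it suffices to compare measures of rectangles.\<close>

lemma driving_noise_joint_law: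
  fixes X\<^sub>0 :: "'w \<Rightarrow> 'e::second_countable_topology" and R :: "nat \<Rightarrow> 'w \<Rightarrow> real ^ 'm"
  assumes "driving_noise M X\<^sub>0 R"
  shows "(\<lambda>\<omega>. (X\<^sub>0 \<omega>, \<lambda>k. R k \<omega>)) \<in> M \<rightarrow>\<^sub>M borel \<Otimes>\<^sub>M Pi\<^sub>M UNIV (\<lambda>_. borel)"
    and "distr M (borel \<Otimes>\<^sub>M Pi\<^sub>M UNIV (\<lambda>_. borel)) (\<lambda>\<omega>. (X\<^sub>0 \<omega>, \<lambda>k. R k \<omega>)) =
      distr M borel X\<^sub>0 \<Otimes>\<^sub>M Pi\<^sub>M UNIV (\<lambda>_. std_gaussian)"
proof -
  interpret prob_space M
    using assms by (simp add: driving_noise_def)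
  have X[measurable]: "X\<^sub>0 \<in> borel_measurable M" and ind: "indep_vars (\<lambda>_. borel) R UNIV"
    and R: "distr M borel (R k) = std_gaussian"
    and ind0: "indep_set
       {X\<^sub>0 -` A \<inter> space M | A. A \<in> sets borel}
       {(\<lambda>\<omega> k. R k \<omega>) -` B \<inter> space M | B. B \<in> sets (Pi\<^sub>M UNIV (\<lambda>_. borel))}" for k
    using assms by (auto simp: driving_noise_def)
  have Rm[measurable]: "R k \<in> borel_measurable M" for k
    using ind by (simp add: indep_vars_def)
  have Rs[measurable]: "(\<lambda>\<omega> k. R k \<omega>) \<in> M \<rightarrow>\<^sub>M Pi\<^sub>M UNIV (\<lambda>_. borel)"
    by (rule measurable_PiM_single') auto
  show meas: "(\<lambda>\<omega>. (X\<^sub>0 \<omega>, \<lambda>k. R k \<omega>)) \<in> M \<rightarrow>\<^sub>M borel \<Otimes>\<^sub>M Pi\<^sub>M UNIV (\<lambda>_. borel)"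
    by measurable
  have RD: "distr M (Pi\<^sub>M UNIV (\<lambda>_. borel)) (\<lambda>\<omega> k. R k \<omega>) = Pi\<^sub>M UNIV (\<lambda>_. std_gaussian)"
    using indep_vars_iff_distr_eq_PiM'[of UNIV R "\<lambda>_. borel"] ind by (simp add: R restrict_def)
  have "distr M borel X\<^sub>0 \<Otimes>\<^sub>M distr M (Pi\<^sub>M UNIV (\<lambda>_. borel)) (\<lambda>\<omega> k. R k \<omega>) =
      distr M (borel \<Otimes>\<^sub>M Pi\<^sub>M UNIV (\<lambda>_. borel)) (\<lambda>\<omega>. (X\<^sub>0 \<omega>, \<lambda>k. R k \<omega>))" (is "?L = ?R")
  proof (rule pair_measure_eqI)
    show "sigma_finite_measure (distr M borel X\<^sub>0)"
      by (intro prob_space_imp_sigma_finite prob_space_distr) measurable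
    show "sigma_finite_measure (distr M (Pi\<^sub>M UNIV (\<lambda>_. borel)) (\<lambda>\<omega> k. R k \<omega>))"
      by (intro prob_space_imp_sigma_finite prob_space_distr) measurable
    show "sets ?L = sets ?R" 
      by (simp cong: sets_pair_measure_cong)
    fix A :: "'e set" and B :: "(nat \<Rightarrow> real ^ 'm) set"
    assume "A \<in> sets (distr M borel X\<^sub>0)" "B \<in> sets (distr M (Pi\<^sub>M UNIV (\<lambda>_. borel)) (\<lambda>\<omega> k. R k \<omega>))"
    then have A[measurable]: "A \<in> sets borel" and B[measurable]: "B \<in> sets (Pi\<^sub>M UNIV (\<lambda>_. borel))" by auto
    have "prob ((X\<^sub>0 -` A \<inter> space M) \<inter> ((\<lambda>\<omega> k. R k \<omega>) -` B \<inter> space M)) =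
        prob (X\<^sub>0 -` A \<inter> space M) * prob ((\<lambda>\<omega> k. R k \<omega>) -` B \<inter> space M)"
      by (rule indep_setD[OF ind0]) (use A B in auto)
    moreover have "(\<lambda>\<omega>. (X\<^sub>0 \<omega>, \<lambda>k. R k \<omega>)) -` (A \<times> B) \<inter> space M =
        (X\<^sub>0 -` A \<inter> space M) \<inter> ((\<lambda>\<omega> k. R k \<omega>) -` B \<inter> space M)"
      by auto
    ultimately show "emeasure (distr M borel X\<^sub>0) A *
        emeasure (distr M (Pi\<^sub>M UNIV (\<lambda>_. borel)) (\<lambda>\<omega> k. R k \<omega>)) B = emeasure ?R (A \<times> B)"
      using measurable_sets[OF X A] measurable_sets[OF Rs B]
      by (subst (1 2 3) emeasure_distr) (auto simp: emeasure_eq_measure ennreal_mult)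
  qed
  then show "?R = distr M borel X\<^sub>0 \<Otimes>\<^sub>M Pi\<^sub>M UNIV (\<lambda>_. std_gaussian)"
    by (simp add: RD)
qed

lemma driving_noise_imp_prob_space_std_gaussian:
  assumes "driving_noise M X\<^sub>0 (R :: nat \<Rightarrow> 'w \<Rightarrow> real ^ 'm)"
  shows "prob_space (std_gaussian :: (real ^ 'm) measure)"
proof -
  interpret prob_space M using assms by (simp add: driving_noise_def)
  have "R 0 \<in> borel_measurable M" and "distr M borel (R 0) = std_gaussian"
    using assms by (auto simp: driving_noise_def indep_vars_def)
  then show ?thesis
    using prob_space_distr[of "R 0" borel] by simp
qed

text \<open>This replaces the probability space carrying the chain by a canonical one, so that chains on
  different spaces become comparable.\<close>

lemma driven_chain_path_law:
  fixes X :: "nat \<Rightarrow> 'w \<Rightarrow> 'x::second_countable_topology" and R :: "nat \<Rightarrow> 'w \<Rightarrow> real ^ 'm"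
    and \<pi> :: "'x \<Rightarrow> 'y::second_countable_topology"
  assumes noise: "driving_noise M (X 0) R"
    and step: "\<And>k \<omega>. \<omega> \<in> space M \<Longrightarrow> X (Suc k) \<omega> = \<Phi> (R k \<omega>) (X k \<omega>)"
    and \<Phi>: "(\<lambda>(r, x). \<Phi> r x) \<in> borel_measurable borel" and \<pi>: "\<pi> \<in> borel_measurable borel"
  shows "distr M borel (\<lambda>\<omega>. restrict (\<lambda>k. \<pi> (X k \<omega>)) {..N}) =
    distr (distr M borel (X 0) \<Otimes>\<^sub>M Pi\<^sub>M UNIV (\<lambda>_. std_gaussian)) borel (observed_orbit \<pi> \<Phi> N)"
proof -
  have "driven_orbit \<Phi> (X 0 \<omega>) (\<lambda>k. R k \<omega>) k = X k \<omega>" if "\<omega> \<in> space M" for k \<omega>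
    by (induction k) (simp_all add: step that)
  then have "distr M borel (\<lambda>\<omega>. restrict (\<lambda>k. \<pi> (X k \<omega>)) {..N}) =
      distr M borel (observed_orbit \<pi> \<Phi> N \<circ> (\<lambda>\<omega>. (X 0 \<omega>, \<lambda>k. R k \<omega>)))"
    by (intro distr_cong) (auto simp: observed_orbit_def)
  also have "\<dots> = distr (distr M (borel \<Otimes>\<^sub>M Pi\<^sub>M UNIV (\<lambda>_. borel)) (\<lambda>\<omega>. (X 0 \<omega>, \<lambda>k. R k \<omega>)))
      borel (observed_orbit \<pi> \<Phi> N)"
    by (rule distr_distr[OF measurable_observed_orbit[OF \<Phi> \<pi>] driving_noise_joint_law(1)[OF noise], symmetric])
  finally show ?thesis
    by (simp only: driving_noise_joint_law(2)[OF noise])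
qed

lemma distr_iid_sequence:
  assumes "prob_space \<mu>" and g[measurable]: "g \<in> \<mu> \<rightarrow>\<^sub>M \<kappa>"
  shows "distr (Pi\<^sub>M (UNIV :: nat set) (\<lambda>_. \<mu>)) (Pi\<^sub>M UNIV (\<lambda>_. \<kappa>)) (\<lambda>r k. g (r k)) = Pi\<^sub>M UNIV (\<lambda>_. distr \<mu> \<kappa> g)"
proof -
  interpret \<mu>: prob_space \<mu> by fact
  interpret P: product_prob_space "\<lambda>_. \<mu>" "UNIV :: nat set" ..
  let ?P = "Pi\<^sub>M (UNIV :: nat set) (\<lambda>_. \<mu>)"
  have c: "distr ?P \<mu> (\<lambda>r. r k) = \<mu>" for k
    by (rule P.PiM_component) simp
  have "P.indep_vars (\<lambda>_. \<mu>) (\<lambda>k r. r k) UNIV"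
    using P.indep_vars_iff_distr_eq_PiM'[of UNIV "\<lambda>k r. r k" "\<lambda>_. \<mu>"] by (simp add: c restrict_def distr_id2)
  then have "P.indep_vars (\<lambda>_. \<kappa>) (\<lambda>k r. g (r k)) UNIV"
    by (rule P.indep_vars_compose2) measurable
  then have "distr ?P (Pi\<^sub>M UNIV (\<lambda>_. \<kappa>)) (\<lambda>r k. g (r k)) = Pi\<^sub>M UNIV (\<lambda>k. distr ?P \<kappa> (\<lambda>r. g (r k)))"
    using P.indep_vars_iff_distr_eq_PiM'[of UNIV "\<lambda>k r. g (r k)" "\<lambda>_. \<kappa>"] by (simp add: restrict_def)
  also have "(\<lambda>k. distr ?P \<kappa> (\<lambda>r. g (r k))) = (\<lambda>_. distr \<mu> \<kappa> g)"
  proof (rule ext)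
    fix k :: nat
    have "distr (distr ?P \<mu> (\<lambda>r. r k)) \<kappa> g = distr ?P \<kappa> (g \<circ> (\<lambda>r. r k))"
      by (rule distr_distr) measurable
    then show "distr ?P \<kappa> (\<lambda>r. g (r k)) = distr \<mu> \<kappa> g"
      by (simp add: c comp_def)
  qed
  finally show ?thesis .
qed

lemma driven_orbit_semiconj:
  assumes "\<And>r x. \<pi> (\<Phi> r x) = \<Psi> (g r) (\<pi> x)"
  shows "\<pi> (driven_orbit \<Phi> x r k) = driven_orbit \<Psi> (\<pi> x) (\<lambda>k. g (r k)) k"
  by (induction k) (simp_all add: assms)

text \<open>If \<open>\<pi>\<close> maps the system driven by the noise \<open>r\<close> to the one driven by \<open>g r\<close>, and \<open>g\<close> preserves
  the standard Gaussian law, then the two systems have the same laws of observed paths. This is used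
  twice: with \<open>\<pi> = id\<close> and \<open>g\<close> a rotation, to change the noise matrix without changing its Gram
  matrix, and with \<open>g = vec_fst\<close>, to forget the auxiliary variable.\<close>

lemma observed_orbit_law_semiconj:
  fixes \<pi> :: "'x::second_countable_topology \<Rightarrow> 'y::second_countable_topology"
    and \<rho> :: "'y \<Rightarrow> 'z::second_countable_topology"
    and g :: "real ^ 'm \<Rightarrow> real ^ 'k"
  assumes "prob_space \<nu>" and \<nu>: "sets \<nu> = sets borel"
    and G: "prob_space (std_gaussian :: (real ^ 'm) measure)"
    and semi: "\<And>r x. \<pi> (\<Phi> r x) = \<Psi> (g r) (\<pi> x)"
    and \<pi>[measurable]: "\<pi> \<in> borel_measurable borel" and g[measurable]: "g \<in> borel_measurable borel"
    and law: "distr std_gaussian borel g = std_gaussian"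
    and \<Psi>: "(\<lambda>(r, x). \<Psi> r x) \<in> borel_measurable borel"
    and \<rho>: "\<rho> \<in> borel_measurable borel"
  shows "distr (\<nu> \<Otimes>\<^sub>M Pi\<^sub>M UNIV (\<lambda>_. std_gaussian)) borel (observed_orbit (\<lambda>x. \<rho> (\<pi> x)) \<Phi> N) =
    distr (distr \<nu> borel \<pi> \<Otimes>\<^sub>M Pi\<^sub>M UNIV (\<lambda>_. std_gaussian)) borel (observed_orbit \<rho> \<Psi> N)"
proof -
  interpret \<nu>: prob_space \<nu> by fact
  interpret G: prob_space "std_gaussian :: (real ^ 'm) measure" by fact
  interpret G': prob_space "std_gaussian :: (real ^ 'k) measure"
    unfolding law[symmetric] by (rule G.prob_space_distr) simp
  interpret P': product_prob_space "\<lambda>_. std_gaussian :: (real ^ 'k) measure" "UNIV :: nat set" ..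
  note [measurable_cong] = \<nu>
  have iid: "distr (Pi\<^sub>M UNIV (\<lambda>_. std_gaussian)) (Pi\<^sub>M UNIV (\<lambda>_. borel)) (\<lambda>r (k::nat). g (r k)) = Pi\<^sub>M UNIV (\<lambda>_. std_gaussian)"
    using distr_iid_sequence[OF G, of g borel] by (simp add: law)
  have gm: "(\<lambda>r (k::nat). g (r k)) \<in> Pi\<^sub>M UNIV (\<lambda>_. std_gaussian) \<rightarrow>\<^sub>M Pi\<^sub>M UNIV (\<lambda>_. borel)"
    by (rule measurable_PiM_single') auto
  have pm: "\<pi> \<in> \<nu> \<rightarrow>\<^sub>M borel" by measurable
  have "distr \<nu> borel \<pi> \<Otimes>\<^sub>M Pi\<^sub>M UNIV (\<lambda>_. std_gaussian) =
      distr (\<nu> \<Otimes>\<^sub>M Pi\<^sub>M UNIV (\<lambda>_. std_gaussian)) (borel \<Otimes>\<^sub>M Pi\<^sub>M UNIV (\<lambda>_. borel)) (\<lambda>(x, r). (\<pi> x, \<lambda>k::nat. g (r k)))"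
    using pair_measure_distr[OF pm gm] P'.sigma_finite_measure by (simp add: iid)
  then have "distr (distr \<nu> borel \<pi> \<Otimes>\<^sub>M Pi\<^sub>M UNIV (\<lambda>_. std_gaussian)) borel (observed_orbit \<rho> \<Psi> N) =
      distr (\<nu> \<Otimes>\<^sub>M Pi\<^sub>M UNIV (\<lambda>_. std_gaussian)) borel
        (observed_orbit \<rho> \<Psi> N \<circ> (\<lambda>(x, r). (\<pi> x, \<lambda>k. g (r k))))"
    using measurable_observed_orbit[OF \<Psi> \<rho>, of N] pm gm
    by (simp add: distr_distr)
  also have "observed_orbit \<rho> \<Psi> N \<circ> (\<lambda>(x, r). (\<pi> x, \<lambda>k. g (r k))) = observed_orbit (\<lambda>x. \<rho> (\<pi> x)) \<Phi> N"
    using driven_orbit_semiconj[of \<pi> \<Phi> \<Psi> g, OF semi]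
    by (auto simp: fun_eq_iff observed_orbit_def)
  finally show ?thesis ..
qed

lemma tendsto_fun_coordinatewise:
  fixes f :: "'i \<Rightarrow> 'a \<Rightarrow> 'b::topological_space"
  assumes "\<And>k. ((\<lambda>i. f i k) \<longlongrightarrow> l k) F"
  shows "(f \<longlongrightarrow> l) F"
proof -
  have "limitin (product_topology (\<lambda>_. euclidean) UNIV) f l F"
    unfolding limitin_componentwise using assms by simp
  then show ?thesis
    by (simp add: euclidean_product_topology)
qed

lemma tendsto_driven_orbit:
  assumes "\<And>X x r. (X \<longlongrightarrow> x) F \<Longrightarrow> ((\<lambda>i. \<Phi> i r (X i)) \<longlongrightarrow> \<Phi>' r x) F"
  shows "((\<lambda>i. driven_orbit (\<Phi> i) x r k) \<longlongrightarrow> driven_orbit \<Phi>' x r k) F"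
  by (induction k) (simp_all add: assms)

text \<open>Path by path, the orbits converge by induction on time; a bounded continuous functional of them
  then converges in mean by dominated convergence.\<close>

lemma integral_observed_orbit_tendsto:
  fixes \<Phi> :: "nat \<Rightarrow> real ^ 'm \<Rightarrow> 'x::second_countable_topology \<Rightarrow> 'x"
    and \<pi> :: "'x \<Rightarrow> 'y::second_countable_topology"
    and f :: "(nat \<Rightarrow> 'y) \<Rightarrow> real"
  assumes "prob_space \<nu>" and \<nu>: "sets \<nu> = sets borel"
    and "prob_space (std_gaussian :: (real ^ 'm) measure)"
    and \<Phi>: "\<And>n. (\<lambda>(r, x). \<Phi> n r x) \<in> borel_measurable borel"
    and \<Phi>': "(\<lambda>(r, x). \<Phi>' r x) \<in> borel_measurable borel"
    and lim: "\<And>X x r. X \<longlonglongrightarrow> x \<Longrightarrow> (\<lambda>n. \<Phi> n r (X n)) \<longlonglongrightarrow> \<Phi>' r x"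
    and \<pi>: "continuous_on UNIV \<pi>"
    and f: "continuous_on UNIV f" "bounded (range f)"
  shows "(\<lambda>n. \<integral>x. f x \<partial>distr (\<nu> \<Otimes>\<^sub>M Pi\<^sub>M UNIV (\<lambda>_. std_gaussian)) borel (observed_orbit \<pi> (\<Phi> n) N)) \<longlonglongrightarrow>
      (\<integral>x. f x \<partial>distr (\<nu> \<Otimes>\<^sub>M Pi\<^sub>M UNIV (\<lambda>_. std_gaussian)) borel (observed_orbit \<pi> \<Phi>' N))"
proof -
  interpret \<nu>: prob_space \<nu> by fact
  interpret G: prob_space "std_gaussian :: (real ^ 'm) measure" by fact
  interpret P: product_prob_space "\<lambda>_. std_gaussian :: (real ^ 'm) measure" "UNIV :: nat set" ..
  interpret Q: pair_prob_space \<nu> "Pi\<^sub>M (UNIV :: nat set) (\<lambda>_. std_gaussian :: (real ^ 'm) measure)" ..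
  let ?Q = "\<nu> \<Otimes>\<^sub>M Pi\<^sub>M (UNIV :: nat set) (\<lambda>_. std_gaussian :: (real ^ 'm) measure)"
  have sets: "sets ?Q = sets (borel \<Otimes>\<^sub>M Pi\<^sub>M (UNIV :: nat set) (\<lambda>_. borel :: (real ^ 'm) measure))"
    by (intro sets_pair_measure_cong sets_PiM_cong) (simp_all add: \<nu>)
  have fm: "f \<in> borel_measurable borel"
    by (rule borel_measurable_continuous_onI[OF f(1)])
  have \<pi>m: "\<pi> \<in> borel_measurable borel"
    by (rule borel_measurable_continuous_onI[OF \<pi>])
  have om: "observed_orbit \<pi> \<Psi> N \<in> borel_measurable ?Q"
    if "(\<lambda>(r, x). \<Psi> r x) \<in> borel_measurable borel" for \<Psi> :: "real ^ 'm \<Rightarrow> 'x \<Rightarrow> 'x"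
    using measurable_observed_orbit[OF that \<pi>m, of N] by (simp add: measurable_cong_sets[OF sets refl])
  obtain B where B: "\<And>x. \<bar>f x\<bar> \<le> B"
    using f(2) by (auto simp: bounded_iff)
  have "(\<lambda>n. \<integral>z. f (observed_orbit \<pi> (\<Phi> n) N z) \<partial>?Q) \<longlonglongrightarrow> (\<integral>z. f (observed_orbit \<pi> \<Phi>' N z) \<partial>?Q)"
  proof (rule integral_dominated_convergence[where w = "\<lambda>_. B"])
    show "AE z in ?Q. (\<lambda>n. f (observed_orbit \<pi> (\<Phi> n) N z)) \<longlonglongrightarrow> f (observed_orbit \<pi> \<Phi>' N z)"
    proof (rule AE_I2)
      fix z :: "'x \<times> (nat \<Rightarrow> real ^ 'm)"
      obtain x r where z: "z = (x, r)" by (cases z)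
      have "(\<lambda>n. \<pi> (driven_orbit (\<Phi> n) x r k)) \<longlonglongrightarrow> \<pi> (driven_orbit \<Phi>' x r k)" for k
        by (rule continuous_on_tendsto_compose[OF \<pi> tendsto_driven_orbit[OF lim]]) simp_all
      then have "(\<lambda>n. observed_orbit \<pi> (\<Phi> n) N z) \<longlonglongrightarrow> observed_orbit \<pi> \<Phi>' N z"
        by (intro tendsto_fun_coordinatewise) (simp add: observed_orbit_def z restrict_def)
      then show "(\<lambda>n. f (observed_orbit \<pi> (\<Phi> n) N z)) \<longlonglongrightarrow> f (observed_orbit \<pi> \<Phi>' N z)"
        by (rule continuous_on_tendsto_compose[OF f(1)]) simp_all
    qed
  qed (use B measurable_compose[OF om[OF \<Phi>] fm] measurable_compose[OF om[OF \<Phi>'] fm] in auto)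
  then show ?thesis
    by (simp add: integral_distr[OF om[OF \<Phi>] fm] integral_distr[OF om[OF \<Phi>'] fm])
qed

section \<open>The two splitting schemes\<close>

lemma deriv_quadratic_form_axis:
  fixes Q :: "real ^ 'n ^ 'n"
  shows "((\<lambda>t. 1 / 2 * ((x + t *\<^sub>R e) \<bullet> (Q *v (x + t *\<^sub>R e)))) has_field_derivative
           1 / 2 * (e \<bullet> (Q *v x) + x \<bullet> (Q *v e))) (at 0)"
proof -
  have eq: "(\<lambda>t. 1 / 2 * ((x + t *\<^sub>R e) \<bullet> (Q *v (x + t *\<^sub>R e)))) =
        (\<lambda>t. 1 / 2 * (x \<bullet> (Q *v x) + t * (e \<bullet> (Q *v x) + x \<bullet> (Q *v e)) + t\<^sup>2 * (e \<bullet> (Q *v e))))"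
    by (rule ext) (simp add: matrix_vector_right_distrib matrix_vector_mult_scaleR
      inner_add_left inner_add_right algebra_simps power2_eq_square)
  show ?thesis
    unfolding eq by (auto intro!: derivative_eq_intros)
qed

text \<open>The force is a linear map plus the gradient of a smooth function. Its continuity is what makes the
  orbits depend continuously on propagator and noise matrix.\<close>

lemma continuous_on_grad_quadratic_plus_smooth:
  fixes Q :: "real ^ 'n ^ 'n" and U V :: "real ^ 'n \<Rightarrow> real"
  assumes V: "smooth_fun V" and U: "\<And>x. U x = 1 / 2 * (x \<bullet> (Q *v x)) + V x"
  shows "continuous_on UNIV (grad U)"
proof -
  have d: "(\<lambda>t. V (x + t *\<^sub>R axis i 1)) field_differentiable at 0" for i x
    using V[unfolded smooth_fun_def, rule_format, of "[]"] by (simp add: iter_partial_def)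
  have c: "continuous_on UNIV (partial_deriv i V)" for i
    using V[unfolded smooth_fun_def, rule_format, of "[i]"] by (simp add: iter_partial_def)
  have "partial_deriv i U x =
      1 / 2 * (axis i 1 \<bullet> (Q *v x) + x \<bullet> (Q *v axis i 1)) + partial_deriv i V x" for i x
    unfolding partial_deriv_def U
    by (intro DERIV_imp_deriv DERIV_add deriv_quadratic_form_axis)
       (use d[of x i] in \<open>simp add: field_differentiable_derivI\<close>)
  then have "grad U = (\<lambda>x. \<chi> i. 1 / 2 * (axis i 1 \<bullet> (Q *v x) + x \<bullet> (Q *v axis i 1)) + partial_deriv i V x)"
    by (simp add: grad_def fun_eq_iff)
  then show ?thesis
    by (auto intro!: continuous_intros c)
qed

lemma tendsto_gle_baoab_step:
  assumes U: "continuous_on UNIV (grad U)"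
    and "(F \<longlongrightarrow> F') net" "(S \<longlongrightarrow> S') net" "(r \<longlongrightarrow> r') net" "(x \<longlongrightarrow> x') net"
  shows "((\<lambda>i. gle_baoab_step h U (F i) (S i) (r i) (x i)) \<longlongrightarrow> gle_baoab_step h U F' S' r' x') net"
proof -
  have grad: "((\<lambda>i. grad U (g i)) \<longlongrightarrow> grad U l) net" if "(g \<longlongrightarrow> l) net" for g l
    using U that by (auto simp: continuous_on_eq_continuous_at intro: isCont_tendsto_compose)
  have proj: "((\<lambda>i. vec_fst (g i)) \<longlongrightarrow> vec_fst l) net" "((\<lambda>i. vec_snd (g i)) \<longlongrightarrow> vec_snd l) net"
    if "(g \<longlongrightarrow> l) net" for g l
    unfolding vec_fst_def vec_snd_def by (intro tendsto_intros that)+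
  show ?thesis
    unfolding gle_baoab_step_def Let_def case_prod_unfold
    by (intro tendsto_intros grad proj tendsto_vec_join tendsto_matrix_vector_mult assms)
qed

lemma continuous_on_ld_baoab_step:
  fixes U :: "real ^ 'n \<Rightarrow> real"
  assumes U: "continuous_on UNIV (grad U)"
  shows "continuous_on UNIV (\<lambda>(r, x). ld_baoab_step h U F S r x)"
proof -
  have grad: "continuous_on UNIV (\<lambda>i. grad U (g i))" if "continuous_on UNIV g" for g :: "'z::topological_space \<Rightarrow> _"
    using U that by (rule continuous_on_compose2) auto
  have mv: "continuous_on UNIV (\<lambda>i. A *v g i)"
    if "continuous_on UNIV g" for A :: "real ^ 'n ^ 'n" and g :: "'z::topological_space \<Rightarrow> _"
    using that unfolding continuous_on_def by (intro ballI tendsto_matrix_vector_mult[OF tendsto_const]) (rule bspec)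
  show ?thesis
    unfolding ld_baoab_step_def Let_def case_prod_unfold
    by (intro continuous_intros grad mv)
qed

lemma measurable_gle_baoab_step:
  assumes "continuous_on UNIV (grad U)"
  shows "(\<lambda>(r, x). gle_baoab_step h U F S r x) \<in> borel_measurable borel"
  unfolding case_prod_unfold
  by (intro borel_measurable_continuous_onI continuous_on_def[THEN iffD2] ballI tendsto_gle_baoab_step
      assms tendsto_const tendsto_fst tendsto_snd tendsto_ident_at)

lemma measurable_ld_baoab_step:
  assumes "continuous_on UNIV (grad U)"
  shows "(\<lambda>(r, x). ld_baoab_step h U F S r x) \<in> borel_measurable borel"
  by (intro borel_measurable_continuous_onI continuous_on_ld_baoab_step assms)

lemma gle_baoab_step_matrix_mult:
  "gle_baoab_step h U F (T ** Q) r x = gle_baoab_step h U F T (Q *v r) x"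
  by (simp add: gle_baoab_step_def matrix_vector_mul_assoc)

definition phase_part :: "'a \<times> 'b \<times> 'c \<Rightarrow> 'a \<times> 'b" where
  "phase_part = (\<lambda>(q, p, s). (q, p))"

text \<open>With block diagonal propagator and noise matrix nothing is transferred from \<open>s\<close> to \<open>p\<close>, and the
  step of \<open>(q, p)\<close> is a Langevin step with the upper left blocks.\<close>

lemma phase_part_gle_baoab_step:
  "phase_part (gle_baoab_step h U (block_mat F 0 0 F') (block_mat S 0 0 S') r x) =
    ld_baoab_step h U F S (vec_fst r) (phase_part x)"
  by (cases x) (simp add: phase_part_def gle_baoab_step_def ld_baoab_step_def Let_def
    vec_fst_add vec_fst_block_mat_diag vec_fst_vec_join)

lemma continuous_on_phase_part: "continuous_on UNIV phase_part"
  unfolding phase_part_def case_prod_unfold by (intro continuous_intros)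

text \<open>The Gram matrix is \<open>\<beta>\<^sup>-\<^sup>1\<close> times the diagonal matrix with entries \<open>1 - exp (- 2 h a\<^sub>i\<^sup>2 / b\<^sub>i)\<close> and \<open>1\<close>.
  It is invertible because the friction \<open>a\<^sub>i\<^sup>2 / b\<^sub>i\<close> is strictly positive, so that every direction of
  the limiting noise is nondegenerate.\<close>

lemma limit_noise_covariance:
  fixes a b :: "real ^ 'n"
  assumes "\<beta> > 0" "h > 0" "\<And>i. a $ i > 0" "\<And>i. b $ i > 0"
    and F: "F = mat_exp (- h *\<^sub>R ld_friction a b)"
    and S: "S ** transpose S = inverse \<beta> *\<^sub>R (mat 1 - F ** transpose F)"
  defines "F\<^sub>0 \<equiv> block_mat F 0 0 0" and "T \<equiv> block_mat S 0 0 (mat (sqrt (inverse \<beta>)))"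
  shows "T ** transpose T = inverse \<beta> *\<^sub>R (mat 1 - F\<^sub>0 ** transpose F\<^sub>0)"
    and "invertible (T ** transpose T)"
proof -
  have one: "mat c ** mat d = (mat (c * d) :: real ^ 'n ^ 'n)" for c d :: real
    by (simp add: vec_eq_iff mat_def matrix_matrix_mult_def if_distrib[of "\<lambda>x. x * _"] cong: if_cong)
  have tz: "transpose 0 = (0 :: real ^ 'n ^ 'n)"
    by (simp add: transpose_def vec_eq_iff)
  show gram: "T ** transpose T = inverse \<beta> *\<^sub>R (mat 1 - F\<^sub>0 ** transpose F\<^sub>0)"
    using \<open>\<beta> > 0\<close> unfolding T_def F\<^sub>0_def
    by (simp add: transpose_block_mat block_mat_mult S mat_1_block_mat diff_block_mat scaleR_block_mat one
       transpose_mat tz) (simp add: block_mat_def vec_eq_iff mat_def split: sum.split)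
  define v where "v = (\<chi> i. exp (- h * (a $ i * a $ i / b $ i)))"
  have fr: "- h *\<^sub>R ld_friction a b = diag_mat (\<chi> i. - h * (a $ i * a $ i / b $ i))"
    unfolding ld_friction_eq[OF assms(4)] by (simp add: diag_mat_def vec_eq_iff)
  have Fv: "F = diag_mat v"
    unfolding F fr mat_exp_diag_mat v_def by (simp add: diag_mat_def vec_eq_iff)
  have v: "0 < v $ i \<and> v $ i < 1" for i
    using assms(2-4) by (simp add: v_def)
  let ?d = "vec_join (\<chi> i. inverse \<beta> * (1 - v $ i * v $ i)) (\<chi> i. inverse \<beta>)"
  have "T ** transpose T = diag_mat ?d"
    unfolding gram F\<^sub>0_def Fv
    by (simp add: transpose_block_mat block_mat_mult mat_1_block_mat diff_block_mat scaleR_block_mat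
       transpose_diag_mat diag_mat_mult tz)
       (simp add: block_mat_def vec_join_def vec_eq_iff diag_mat_def mat_def split: sum.split)
  moreover have "det (diag_mat ?d) \<noteq> 0"
  proof -
    have "?d $ i \<noteq> 0" for i
    proof (cases i)
      case (Inl k)
      have "v $ k * v $ k < 1"
        using v[of k] mult_strict_mono[of "v $ k" 1 "v $ k" 1] by simp
      then show ?thesis using Inl \<open>\<beta> > 0\<close> by (simp add: vec_join_def)
    next
      case (Inr k)
      then show ?thesis using \<open>\<beta> > 0\<close> by (simp add: vec_join_def)
    qed
    then show ?thesis
      by (subst det_diagonal) (auto simp: diag_mat_def)
  qed
  ultimately show "invertible (T ** transpose T)"
    by (simp add: invertible_det_nz)
qed

section \<open>Convergence in law\<close>

text \<open>A sequence of values avoiding a neighbourhood of \<open>L\<close> would have no subsequence converging to \<open>L\<close>.\<close>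

lemma tendsto_at_right_subsequenceI:
  fixes f :: "real \<Rightarrow> 'b::topological_space"
  assumes "\<And>e. (\<And>n. e n > 0) \<Longrightarrow> e \<longlonglongrightarrow> 0 \<Longrightarrow> \<exists>r. strict_mono (r :: nat \<Rightarrow> nat) \<and> (\<lambda>n. f (e (r n))) \<longlonglongrightarrow> L"
  shows "(f \<longlongrightarrow> L) (at_right 0)"
proof (rule tendsto_at_right_sequentially[of 0 1])
  fix e :: "nat \<Rightarrow> real"
  assume e: "\<And>n. 0 < e n" "e \<longlonglongrightarrow> 0"
  show "(\<lambda>n. f (e n)) \<longlonglongrightarrow> L"
  proof (rule topological_tendstoI, rule ccontr)
    fix W assume W: "open W" "L \<in> W" and "\<not> (\<forall>\<^sub>F n in sequentially. f (e n) \<in> W)"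
    from not_eventually_sequentiallyD[OF this(3)]
    obtain s :: "nat \<Rightarrow> nat" where s: "strict_mono s" "\<And>n. f (e (s n)) \<notin> W" by blast
    obtain r :: "nat \<Rightarrow> nat" where "(\<lambda>n. f (e (s (r n)))) \<longlonglongrightarrow> L"
      using assms[of "\<lambda>n. e (s n)"] e LIMSEQ_subseq_LIMSEQ[OF e(2) s(1)] by (auto simp: comp_def)
    then have "\<forall>\<^sub>F n in sequentially. f (e (s (r n))) \<in> W"
      using W by (rule topological_tendstoD)
    then show False
      using s(2) by simp
  qed
qed simp

theorem theorem4p1:
  fixes a b :: "real ^ 'n"
    and \<Omega> :: "real ^ 'n ^ 'n"
    and U\<^sub>2 U :: "real ^ 'n \<Rightarrow> real"
    and \<beta> h :: real
    and \<nu> :: "((real ^ 'n) \<times> (real ^ 'n) \<times> (real ^ 'n)) measure"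
    and M :: "real \<Rightarrow> 'w measure"
    and q p s :: "real \<Rightarrow> nat \<Rightarrow> 'w \<Rightarrow> real ^ 'n"
    and M' :: "'v measure"
    and q' p' :: "nat \<Rightarrow> 'v \<Rightarrow> real ^ 'n"
    and N :: nat
  assumes "\<beta> > 0" and "h > 0"
    and "\<And>i. a $ i > 0" and "\<And>i. b $ i > 0"
    and "sym_pos_def \<Omega>"
    and "smooth_fun U\<^sub>2"
    and "\<And>is. is \<noteq> [] \<Longrightarrow> bounded (range (iter_partial is U\<^sub>2))"
    and "\<And>x. U x = 1 / 2 * (x \<bullet> (\<Omega> *v x)) + U\<^sub>2 x"
    and "\<And>\<epsilon>. \<epsilon> > 0 \<Longrightarrow>
           gle_baoab_chain \<beta> h U a b (inverse \<epsilon>) (inverse (\<epsilon>\<^sup>2)) (M \<epsilon>) (q \<epsilon>) (p \<epsilon>) (s \<epsilon>)"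
    and "\<And>\<epsilon>. \<epsilon> > 0 \<Longrightarrow> distr (M \<epsilon>) borel (\<lambda>\<omega>. (q \<epsilon> 0 \<omega>, p \<epsilon> 0 \<omega>, s \<epsilon> 0 \<omega>)) = \<nu>"
    and "ld_baoab_chain \<beta> h U (ld_friction a b) (ld_diffusion a b) M' q' p'"
    and "distr M' borel (\<lambda>\<omega>. (q' 0 \<omega>, p' 0 \<omega>)) = distr \<nu> borel (\<lambda>(x, y, z). (x, y))"
  shows "weak_limit (\<lambda>\<epsilon>. path_law (M \<epsilon>) (q \<epsilon>) (p \<epsilon>) N) (path_law M' q' p' N) (at_right 0)"
proof -
  have grad: "continuous_on UNIV (grad U)"
    using assms(6,8) by (rule continuous_on_grad_quadratic_plus_smooth)
  note gle_meas = measurable_gle_baoab_step[OF grad] and ld_meas = measurable_ld_baoab_step[OF grad]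
  have \<pi>m: "phase_part \<in> borel_measurable (borel :: ((real ^ 'n) \<times> (real ^ 'n) \<times> (real ^ 'n)) measure)"
    by (rule borel_measurable_continuous_onI[OF continuous_on_phase_part])
  define F where "F = (\<lambda>\<epsilon>. mat_exp (- h *\<^sub>R gle_Gamma a b (inverse \<epsilon>) (inverse (\<epsilon>\<^sup>2))))"
  define gle_law where "gle_law = (\<lambda>F S. distr (\<nu> \<Otimes>\<^sub>M Pi\<^sub>M (UNIV :: nat set) (\<lambda>_. std_gaussian)) borel
    (observed_orbit phase_part (gle_baoab_step h U F S) N))"

  \<comment> \<open>all chains on the common space, with a choice of noise matrix for each \<open>\<epsilon>\<close>\<close>
  have "\<exists>S. S ** transpose S = inverse \<beta> *\<^sub>R (mat 1 - F \<epsilon> ** transpose (F \<epsilon>)) \<and>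
      path_law (M \<epsilon>) (q \<epsilon>) (p \<epsilon>) N = gle_law (F \<epsilon>) S \<and>
      prob_space \<nu> \<and> sets \<nu> = sets borel \<and> prob_space (std_gaussian :: (real ^ ('n + 'n)) measure)"
    if pos: "\<epsilon> > 0" for \<epsilon>
  proof -
    obtain S R where S: "S ** transpose S = inverse \<beta> *\<^sub>R (mat 1 - F \<epsilon> ** transpose (F \<epsilon>))"
      and noise: "driving_noise (M \<epsilon>) (\<lambda>\<omega>. (q \<epsilon> 0 \<omega>, p \<epsilon> 0 \<omega>, s \<epsilon> 0 \<omega>)) R"
      and step: "\<And>k \<omega>. \<omega> \<in> space (M \<epsilon>) \<Longrightarrow> (q \<epsilon> (Suc k) \<omega>, p \<epsilon> (Suc k) \<omega>, s \<epsilon> (Suc k) \<omega>) =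
          gle_baoab_step h U (F \<epsilon>) S (R k \<omega>) (q \<epsilon> k \<omega>, p \<epsilon> k \<omega>, s \<epsilon> k \<omega>)"
      using assms(9)[OF pos] unfolding gle_baoab_chain_def F_def by blast
    have "path_law (M \<epsilon>) (q \<epsilon>) (p \<epsilon>) N = gle_law (F \<epsilon>) S"
      using driven_chain_path_law[OF noise step gle_meas \<pi>m, of N] assms(10)[OF pos]
      by (simp add: path_law_def gle_law_def phase_part_def)
    moreover have "prob_space \<nu>"
      unfolding assms(10)[OF pos, symmetric]
      using noise by (intro prob_space.prob_space_distr) (auto simp: driving_noise_def)
    moreover have "sets \<nu> = sets borel"
      unfolding assms(10)[OF pos, symmetric] by simp
    ultimately show ?thesis
      using S driving_noise_imp_prob_space_std_gaussian[OF noise] by blast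
  qed
  then obtain S where S: "\<And>\<epsilon>. \<epsilon> > 0 \<Longrightarrow> S \<epsilon> ** transpose (S \<epsilon>) = inverse \<beta> *\<^sub>R (mat 1 - F \<epsilon> ** transpose (F \<epsilon>))"
    and law: "\<And>\<epsilon>. \<epsilon> > 0 \<Longrightarrow> path_law (M \<epsilon>) (q \<epsilon>) (p \<epsilon>) N = gle_law (F \<epsilon>) (S \<epsilon>)"
    and \<nu>: "prob_space \<nu>" "sets \<nu> = sets borel" and G: "prob_space (std_gaussian :: (real ^ ('n + 'n)) measure)"
    by (metis zero_less_one)

  obtain F' S' R' where F': "F' = mat_exp (- h *\<^sub>R ld_friction a b)"
    and S': "S' ** transpose S' = inverse \<beta> *\<^sub>R (mat 1 - F' ** transpose F')"
    and noise': "driving_noise M' (\<lambda>\<omega>. (q' 0 \<omega>, p' 0 \<omega>)) R'"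
    and step': "\<And>k \<omega>. \<omega> \<in> space M' \<Longrightarrow> (q' (Suc k) \<omega>, p' (Suc k) \<omega>) =
          ld_baoab_step h U F' S' (R' k \<omega>) (q' k \<omega>, p' k \<omega>)"
    using assms(11) unfolding ld_baoab_chain_def by blast
  have law': "path_law M' q' p' N = distr (distr \<nu> borel phase_part \<Otimes>\<^sub>M Pi\<^sub>M UNIV (\<lambda>_. std_gaussian)) borel
      (observed_orbit (\<lambda>x. x) (ld_baoab_step h U F' S') N)"
    using driven_chain_path_law[OF noise' step' ld_meas, of "\<lambda>x. x" N] assms(12)
    by (simp add: path_law_def phase_part_def)

  define F\<^sub>0 where "F\<^sub>0 = block_mat F' 0 0 0"
  define T where "T = block_mat S' 0 0 (mat (sqrt (inverse \<beta>)))"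
  have T: "T ** transpose T = inverse \<beta> *\<^sub>R (mat 1 - F\<^sub>0 ** transpose F\<^sub>0)" "invertible (T ** transpose T)"
    unfolding T_def F\<^sub>0_def using limit_noise_covariance[OF assms(1-4) F' S'] by auto

  \<comment> \<open>with the limiting propagator, every noise matrix with the Gram matrix of \<open>T\<close> yields the
    Langevin path law\<close>
  have gle_T: "gle_law F\<^sub>0 T = path_law M' q' p' N"
    unfolding gle_law_def law'
    using observed_orbit_law_semiconj[OF \<nu> G, of phase_part "gle_baoab_step h U F\<^sub>0 T" "ld_baoab_step h U F' S'" vec_fst "\<lambda>x. x" N]
    by (simp add: F\<^sub>0_def T_def phase_part_gle_baoab_step \<pi>m ld_meas std_gaussian_distr_vec_fst
       driving_noise_imp_prob_space_std_gaussian[OF noise'] measurable_vec_fst)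
  have gle_limit: "gle_law F\<^sub>0 S\<^sub>0 = path_law M' q' p' N"
    if gram: "S\<^sub>0 ** transpose S\<^sub>0 = T ** transpose T" for S\<^sub>0
  proof -
    obtain Q where Q: "orthogonal_matrix Q" "S\<^sub>0 = T ** Q"
      using equal_gram_imp_orthogonal_factor[OF gram T(2)] .
    have Qm: "(*v) Q \<in> borel_measurable borel"
      by (intro borel_measurable_continuous_onI matrix_vector_mult_linear_continuous_on)
    have "gle_law F\<^sub>0 S\<^sub>0 = gle_law F\<^sub>0 T"
      using observed_orbit_law_semiconj[OF \<nu> G, of "\<lambda>x. x" "gle_baoab_step h U F\<^sub>0 S\<^sub>0" "gle_baoab_step h U F\<^sub>0 T"
          "(*v) Q" phase_part N] distr_id2[OF \<nu>(2)[symmetric]]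
      by (simp add: gle_law_def Q gle_baoab_step_matrix_mult Qm std_gaussian_distr_orthogonal gle_meas \<pi>m)
    then show ?thesis
      using gle_T by simp
  qed

  show ?thesis
    unfolding weak_limit_def
  proof (intro allI impI, elim conjE)
    fix f :: "(nat \<Rightarrow> (real ^ 'n) \<times> (real ^ 'n)) \<Rightarrow> real"
    assume f: "continuous_on UNIV f" "bounded (range f)"
    show "((\<lambda>\<epsilon>. \<integral>x. f x \<partial>path_law (M \<epsilon>) (q \<epsilon>) (p \<epsilon>) N) \<longlongrightarrow> (\<integral>x. f x \<partial>path_law M' q' p' N)) (at_right 0)"
    proof (rule tendsto_at_right_subsequenceI)
      fix e :: "nat \<Rightarrow> real"
      assume e: "\<And>n. e n > 0" "e \<longlonglongrightarrow> 0"
      have "filterlim e (at_right 0) sequentially"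
        using e by (simp add: filterlim_at less_imp_neq[OF e(1), symmetric])
      then have Flim: "(\<lambda>n. F (e n)) \<longlonglongrightarrow> F\<^sub>0"
        using tendsto_mat_exp_gle_Gamma[OF assms(3,4,2)] unfolding F_def F\<^sub>0_def F'
        by (rule filterlim_compose[rotated])
      have "(\<lambda>n. S (e n) ** transpose (S (e n))) \<longlonglongrightarrow> T ** transpose T"
        unfolding S[OF e(1)] T(1)
        by (intro tendsto_intros tendsto_matrix_mult tendsto_transpose Flim)
      then obtain r S\<^sub>0 where r: "strict_mono (r :: nat \<Rightarrow> nat)" and Slim: "(\<lambda>n. S (e (r n))) \<longlonglongrightarrow> S\<^sub>0"
        and S\<^sub>0: "S\<^sub>0 ** transpose S\<^sub>0 = T ** transpose T"
        by (rule convergent_gram_imp_convergent_subsequence)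
      have "(\<lambda>n. F (e (r n))) \<longlonglongrightarrow> F\<^sub>0"
        using LIMSEQ_subseq_LIMSEQ[OF Flim r] by (simp add: comp_def)
      then have "(\<lambda>n. \<integral>x. f x \<partial>gle_law (F (e (r n))) (S (e (r n)))) \<longlonglongrightarrow> (\<integral>x. f x \<partial>gle_law F\<^sub>0 S\<^sub>0)"
        unfolding gle_law_def
        by (intro integral_observed_orbit_tendsto \<nu> G gle_meas continuous_on_phase_part f
            tendsto_gle_baoab_step grad Slim tendsto_const)
      then show "\<exists>r. strict_mono r \<and>
          (\<lambda>n. \<integral>x. f x \<partial>path_law (M (e (r n))) (q (e (r n))) (p (e (r n))) N) \<longlonglongrightarrow>
            (\<integral>x. f x \<partial>path_law M' q' p' N)"
        using r law[OF e(1)] gle_limit[OF S\<^sub>0] by auto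
    qed
  qed
qed

end
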